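(* Let $R_1,\ldots,R_n$ be normal affine semigroup rings over a field $\mathbb{F}$. For each $1\le i\le n$, suppose there is an integer $D_i>0$ such that $P^{(D_i(r-1)+1)}\subseteq P^r$ for all integers $r>0$ and all monomial primes $P\subseteq R_i$. Set $D:=\max\{D_1,\ldots,D_n\}$. Then $Q^{(D(r-1)+1)}\subseteq Q^r$ for all integers $r>0$ and any monomial prime $Q$ in the normal affine semigroup ring $R=R_1\otimes_{\mathbb{F}}\cdots\otimes_{\mathbb{F}}R_n$.
   Context: A normal affine semigroup ring (normal toric ring) over a field $\mathbb{F}$ is a semigroup algebra $\mathbb{F}[C^\vee\cap M]$, where $M,N$ are dual lattices (free abelian groups of finite rank with a perfect pairing $\langle\cdot,\cdot\rangle:M\times N\to\mathbb{Z}$), $C=\operatorname{Cone}(G)\subseteq N_{\mathbb{R}}=N\otimes_{\mathbb{Z}}\mathbb{R}$ is the convex polyhedral cone generated by a finite set $G\subseteq N\setminus\{0\}$, and $C^\vee=\{w\in M_{\mathbb{R}}:\langle w,v\rangle\ge 0\ \forall v\in C\}$. One may always take $C$ to be pointed (containing no line through the origin). The ring has an $\mathbb{F}$-basis of (Laurent) monomials $\chi^m$, $m\in C^\vee\cap M$; an ideal is monomial if it is generated by a set of such monomials, and a monomial prime is a prime monomial ideal. If $R_i=\mathbb{F}[C_i^\vee\cap M_i]$, then $R_1\otimes_{\mathbb{F}}\cdots\otimes_{\mathbb{F}}R_n\cong\mathbb{F}[(C_1\times\cdots\times C_n)^\vee\cap(M_1\times\cdots\times M_n)]$, whose monomials are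 the products (pure tensors) of monomials of the $R_i$. For a proper ideal $I$ in a nonzero Noetherian ring $A$ and an integer $a>0$, the $a$-th symbolic power is $I^{(a)}=\{f\in A: sf\in I^a\text{ for some }s\in W\}$, where $W=A\setminus\bigcup\{P: P\in\operatorname{Ass}_A(A/I)\}$. *)

theory Defs
  imports
    "HOL-Analysis.Analysis"
    "HOL-Library.Poly_Mapping"
    "HOL-Algebra.Algebra"
begin

section \<open>Dual lattices and cones\<close>

text \<open>
  Lattices live in ambient real vector spaces (of possibly larger or infinite dimension):
  \<open>L\<close> is the \<open>\<int>\<close>-span of a finite \<open>\<real>\<close>-linearly independent set, so that
  \<open>L \<otimes> \<real>\<close> is \<open>span L\<close>. Every free abelian group of finite rank arises in this way.
\<close>

definition is_lattice :: "'v::real_vector set \<Rightarrow> bool"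
  where "is_lattice L \<longleftrightarrow>
    (\<exists>B. finite B \<and> independent B \<and> L = {\<Sum>b\<in>B. real_of_int (k b) *\<^sub>R b | k. True})"

definition int_hom_on :: "'v::real_vector set \<Rightarrow> ('v \<Rightarrow> int) \<Rightarrow> bool"
  where "int_hom_on L h \<longleftrightarrow> (\<forall>x\<in>L. \<forall>y\<in>L. h (x + y) = h x + h y)"

text \<open>
  The pairing \<open>M \<times> N \<rightarrow> \<int>\<close> is given together with its real bilinear extension.
  Perfectness says that \<open>M \<rightarrow> Hom(N, \<int>)\<close> and \<open>N \<rightarrow> Hom(M, \<int>)\<close> are bijective.
\<close>

definition dual_lattices ::
    "'v::real_vector set \<Rightarrow> 'w::real_vector set \<Rightarrow> ('v \<Rightarrow> 'w \<Rightarrow> real) \<Rightarrow> bool"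
  where "dual_lattices M N p \<longleftrightarrow>
    is_lattice M \<and> is_lattice N \<and> bilinear p \<and>
    (\<forall>w\<in>M. \<forall>v\<in>N. p w v \<in> \<int>) \<and>
    (\<forall>h. int_hom_on N h \<longrightarrow> (\<exists>!w. w \<in> M \<and> (\<forall>v\<in>N. p w v = real_of_int (h v)))) \<and>
    (\<forall>h. int_hom_on M h \<longrightarrow> (\<exists>!v. v \<in> N \<and> (\<forall>w\<in>M. p w v = real_of_int (h w))))"

definition dual_cone ::
    "'v::real_vector set \<Rightarrow> ('v \<Rightarrow> 'w::real_vector \<Rightarrow> real) \<Rightarrow> 'w set \<Rightarrow> 'v set"
  where "dual_cone M p C = {w \<in> span M. \<forall>v\<in>C. 0 \<le> p w v}"

text \<open>\<open>C\<^sup>\<or> \<inter> M\<close> for \<open>C = Cone(G)\<close>; note that \<open>convex_cone hull {} = {0}\<close>.\<close>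

definition normal_semigroup ::
    "'v::real_vector set \<Rightarrow> ('v \<Rightarrow> 'w::real_vector \<Rightarrow> real) \<Rightarrow> 'w set \<Rightarrow> 'v set"
  where "normal_semigroup M p G = dual_cone M p (convex_cone hull G) \<inter> M"


section \<open>Semigroup algebras\<close>

text \<open>
  The type \<^typ>\<open>'v \<Rightarrow>\<^sub>0 'f\<close> is the group algebra of all of \<open>'v\<close> over the field \<open>'f\<close>;
  the semigroup algebra of \<open>S\<close> consists of the elements supported on \<open>S\<close>.
\<close>

definition semigroup_algebra ::
    "'v::comm_monoid_add set \<Rightarrow> ('f::field, 'v \<Rightarrow>\<^sub>0 'f) module"
  where "semigroup_algebra S =
    \<lparr>carrier = {f. Poly_Mapping.keys f \<subseteq> S}, mult = (*), one = 1, ring.zero = 0, add = (+),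
     smult = (\<lambda>c f. Poly_Mapping.single 0 c * f)\<rparr>"

definition monomials :: "'v set \<Rightarrow> ('v \<Rightarrow>\<^sub>0 'f::field) set"
  where "monomials S = (\<lambda>m. Poly_Mapping.single m 1) ` S"

text \<open>
  \<open>Mon\<close> is the set of monomials of \<open>R\<close>. The generating set \<open>B\<close> may be empty, so the zero ideal
  is monomial.
\<close>

definition monomial_prime :: "('a, 'b) ring_scheme \<Rightarrow> 'a set \<Rightarrow> 'a set \<Rightarrow> bool"
  where "monomial_prime R Mon P \<longleftrightarrow> primeideal P R \<and> (\<exists>B\<subseteq>Mon. P = Idl\<^bsub>R\<^esub> B)"


section \<open>Tensor products of algebras\<close>

text \<open>
  The tensor product of a finite family of commutative algebras \<open>A i\<close>, \<open>i \<in> I\<close>, over the field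
  \<open>'f\<close>: the free vector space on the tuples of \<open>\<Prod>i\<in>I. A i\<close>, multiplied by extending the
  componentwise product of tuples bilinearly, modulo the relations making tuples multilinear.
  (The span of these relations is already closed under multiplication, so the generated ideal
  is that span.) The class of a tuple is the corresponding pure tensor.
\<close>

definition tuple_algebra ::
    "'i set \<Rightarrow> ('i \<Rightarrow> ('f::field, 'a) module) \<Rightarrow> (('i \<Rightarrow> 'a) \<Rightarrow>\<^sub>0 'f) ring"
  where "tuple_algebra I A =
    \<lparr>carrier = {f. Poly_Mapping.keys f \<subseteq> (\<Pi>\<^sub>E i\<in>I. carrier (A i))},
     mult = (\<lambda>f g. \<Sum>x\<in>Poly_Mapping.keys f. \<Sum>y\<in>Poly_Mapping.keys g.
               Poly_Mapping.single (\<lambda>i\<in>I. x i \<otimes>\<^bsub>A i\<^esub> y i)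
                 (Poly_Mapping.lookup f x * Poly_Mapping.lookup g y)),
     one = Poly_Mapping.single (\<lambda>i\<in>I. \<one>\<^bsub>A i\<^esub>) 1, ring.zero = 0, add = (+)\<rparr>"

definition multilinear_relations ::
    "'i set \<Rightarrow> ('i \<Rightarrow> ('f::field, 'a) module) \<Rightarrow> (('i \<Rightarrow> 'a) \<Rightarrow>\<^sub>0 'f) set"
  where "multilinear_relations I A =
    {Poly_Mapping.single (x(j := u \<oplus>\<^bsub>A j\<^esub> v)) 1
       - Poly_Mapping.single (x(j := u)) 1 - Poly_Mapping.single (x(j := v)) 1 | x j u v.
       x \<in> (\<Pi>\<^sub>E i\<in>I. carrier (A i)) \<and> j \<in> I \<and> u \<in> carrier (A j) \<and> v \<in> carrier (A j)} \<union>
    {Poly_Mapping.single (x(j := c \<odot>\<^bsub>A j\<^esub> u)) 1 - Poly_Mapping.single (x(j := u)) c | x j c u.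
       x \<in> (\<Pi>\<^sub>E i\<in>I. carrier (A i)) \<and> j \<in> I \<and> u \<in> carrier (A j)}"

definition tensor_ideal ::
    "'i set \<Rightarrow> ('i \<Rightarrow> ('f::field, 'a) module) \<Rightarrow> (('i \<Rightarrow> 'a) \<Rightarrow>\<^sub>0 'f) set"
  where "tensor_ideal I A = Idl\<^bsub>tuple_algebra I A\<^esub> (multilinear_relations I A)"

definition tensor_algebra ::
    "'i set \<Rightarrow> ('i \<Rightarrow> ('f::field, 'a) module) \<Rightarrow> (('i \<Rightarrow> 'a) \<Rightarrow>\<^sub>0 'f) set ring"
  where "tensor_algebra I A = tuple_algebra I A Quot tensor_ideal I A"

definition pure_tensor ::
    "'i set \<Rightarrow> ('i \<Rightarrow> ('f::field, 'a) module) \<Rightarrow> ('i \<Rightarrow> 'a) \<Rightarrow> (('i \<Rightarrow> 'a) \<Rightarrow>\<^sub>0 'f) set"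
  where "pure_tensor I A x = tensor_ideal I A +>\<^bsub>tuple_algebra I A\<^esub> Poly_Mapping.single x 1"

text \<open>
  The monomials of \<open>\<Otimes>i\<in>I. \<F>[S i]\<close> are the pure tensors of monomials of the factors; under
  \<open>\<Otimes>i\<in>I. \<F>[S i] \<cong> \<F>[\<Prod>i\<in>I. S i]\<close> these are the usual monomials.
\<close>

definition tensor_monomials ::
    "'i set \<Rightarrow> ('i \<Rightarrow> 'v::comm_monoid_add set) \<Rightarrow> (('i \<Rightarrow> 'v \<Rightarrow>\<^sub>0 'f::field) \<Rightarrow>\<^sub>0 'f) set set"
  where "tensor_monomials I S =
    pure_tensor I (\<lambda>i. semigroup_algebra (S i)) ` (\<Pi>\<^sub>E i\<in>I. monomials (S i))"


section \<open>Symbolic powers\<close>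

text \<open>The set below is the annihilator of the class of \<open>x\<close> in \<open>A/I\<close>.\<close>

definition associated_primes :: "('a, 'b) ring_scheme \<Rightarrow> 'a set \<Rightarrow> 'a set set"
  where "associated_primes A I =
    {P. primeideal P A \<and> (\<exists>x\<in>carrier A. P = {a \<in> carrier A. a \<otimes>\<^bsub>A\<^esub> x \<in> I})}"

text \<open>Powers in the multiplicative monoid \<^const>\<open>ideals_set\<close> are the ordinary powers of ideals.\<close>

definition ideal_power :: "('a, 'b) ring_scheme \<Rightarrow> 'a set \<Rightarrow> nat \<Rightarrow> 'a set"
  where "ideal_power A I r = I [^]\<^bsub>ideals_set A\<^esub> r"

definition symbolic_power :: "('a, 'b) ring_scheme \<Rightarrow> 'a set \<Rightarrow> nat \<Rightarrow> 'a set"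
  where "symbolic_power A I a =
    {f \<in> carrier A. \<exists>s \<in> carrier A - \<Union> (associated_primes A I). s \<otimes>\<^bsub>A\<^esub> f \<in> ideal_power A I a}"

end

theory Submission
  imports Defs
begin

text \<open>
  Under \<open>\<Otimes>i. \<F>[S i] \<cong> \<F>[\<Prod>i. S i]\<close> everything becomes combinatorics of exponents. A monomial prime is
  spanned by the complement \<open>E\<close> of a face \<open>F\<close> of the semigroup \<open>S\<close>, its \<open>r\<close>-th power by the sums of \<open>r\<close>
  elements of \<open>E\<close> and one of \<open>S\<close>, and its \<open>a\<close>-th symbolic power by the \<open>t\<close> such that \<open>u + t\<close> lies in the
  \<open>a\<close>-th power for some \<open>u \<in> F\<close>. For the last point let \<open>s f \<in> P\<^sup>a\<close> and write \<open>s = s\<^sub>1 + s\<^sub>2\<close> with \<open>s\<^sub>1 \<noteq> 0\<close>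
  supported on \<open>F\<close> and \<open>s\<^sub>2 \<in> P\<close>: modulo the span \<open>K\<close> of these \<open>t\<close> one has \<open>s\<^sub>1 f \<equiv> - s\<^sub>2 f\<close>, so
  \<open>s\<^sub>1\<^sup>a f \<equiv> (- s\<^sub>2)\<^sup>a f \<equiv> 0\<close>, and \<open>s\<^sub>1\<close> is a nonzerodivisor modulo \<open>K\<close> because the exponents lie in a
  torsion-free group.

  In a product every element of \<open>E\<close> has a component in some \<open>E\<^sub>i\<close>. Hence if \<open>u + t\<close> is in the power
  of order \<open>D (r - 1) + 1\<close>, then the components satisfy \<open>t\<^sub>i \<in> E\<^sub>i\<^bsup>(a i)\<^esup>\<close> with \<open>\<Sum>i. a i = D (r - 1) + 1\<close>.
  By hypothesis \<open>t\<^sub>i \<in> E\<^sub>i\<^bsup>r i\<^esup>\<close> for \<open>r i = \<lceil>a i / D\<rceil>\<close>, and \<open>\<Sum>i. r i \<ge> r\<close>.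
\<close>

section \<open>Finitely supported functions: additive extension, splitting and induction\<close>

abbreviation "keys \<equiv> Poly_Mapping.keys"
abbreviation "lookup \<equiv> Poly_Mapping.lookup"
abbreviation "single \<equiv> Poly_Mapping.single"

text \<open>The extension of a family of maps \<open>H k\<close> on coefficients to finite sums of
  terms. Only additivity of each \<open>H k\<close> is asked for, so this one construction serves
  the embeddings, the evaluation, its section and the tuple product below.\<close>

definition additive_sum ::
    "('a \<Rightarrow> 'b::comm_monoid_add \<Rightarrow> 'c::comm_monoid_add) \<Rightarrow> ('a \<Rightarrow>\<^sub>0 'b) \<Rightarrow> 'c"
  where "additive_sum H f = (\<Sum>k\<in>keys f. H k (lookup f k))"

lemma additive_sum_zero [simp]: "additive_sum H 0 = 0"
  by (simp add: additive_sum_def)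

lemma additive_sum_single: "H k 0 = 0 \<Longrightarrow> additive_sum H (single k c) = H k c"
  by (simp add: additive_sum_def)

lemma additive_sum_add:
  assumes "\<And>k. H k 0 = 0" "\<And>k c d. H k (c + d) = H k c + H k d"
  shows "additive_sum H (f + g) = additive_sum H f + additive_sum H g"
  unfolding additive_sum_def by (rule setsum_keys_plus_distrib) (use assms in auto)

lemma keys_additive_sum_single: "keys (additive_sum (\<lambda>k. single (h k)) f) \<subseteq> h ` keys f"
proof -
  have "keys (single (h k) (lookup f k)) \<subseteq> h ` keys f" if "k \<in> keys f" for k
    using that by simp
  then show ?thesis
    unfolding additive_sum_def using Poly_Mapping.keys_sum by fast
qed

text \<open>Used to strip from an element its part inside a monomial ideal; the remainder has all
  its exponents outside.\<close>

lemma poly_mapping_split: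
  fixes f :: "'a \<Rightarrow>\<^sub>0 'b::comm_monoid_add"
  obtains g h where "f = g + h" "keys g = keys f \<inter> E" "keys h = keys f - E"
proof
  let ?g = "Poly_Mapping.mapp (\<lambda>k c. c when k \<in> E) f"
  let ?h = "Poly_Mapping.mapp (\<lambda>k c. c when k \<notin> E) f"
  show "f = ?g + ?h"
    by (rule poly_mapping_eqI) (auto simp: lookup_add lookup_mapp when_def in_keys_iff)
  show "keys ?g = keys f \<inter> E" "keys ?h = keys f - E"
    by (auto simp: in_keys_iff lookup_mapp when_def split: if_splits)
qed

lemma poly_mapping_sum_single: "f = (\<Sum>k\<in>keys f. single k (lookup f k))"
  by (rule poly_mapping_eqI)
    (auto simp: lookup_sum lookup_single when_def in_keys_iff sum.delta' if_distrib cong: if_cong)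

text \<open>The additive step keeps the support bound \<open>A\<close>, so a property of elements
  with restricted support can be checked on single terms.\<close>

lemma poly_mapping_additive_induct [consumes 1, case_names zero single add]:
  fixes f :: "'a \<Rightarrow>\<^sub>0 'b::comm_monoid_add"
  assumes "keys f \<subseteq> A"
    and "P 0" "\<And>k c. k \<in> A \<Longrightarrow> P (single k c)"
    and "\<And>f g. keys f \<subseteq> A \<Longrightarrow> keys g \<subseteq> A \<Longrightarrow> P f \<Longrightarrow> P g \<Longrightarrow> P (f + g)"
  shows "P f"
proof -
  \<comment> \<open>The support bound is part of the claim because the additivity assumption
    requires it for both summands.\<close>
  have "P (\<Sum>k\<in>K. single k (lookup f k)) \<and> keys (\<Sum>k\<in>K. single k (lookup f k)) \<subseteq> A"
    if "finite K" "K \<subseteq> A" for K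
    using that
  proof (induction K)
    case (insert k K)
    then show ?case
      using Poly_Mapping.keys_add[of "single k (lookup f k)" "\<Sum>k\<in>K. single k (lookup f k)"]
      by (auto intro!: assms split: if_splits)
  qed (use assms(2) in auto)
  then show ?thesis
    using assms(1) poly_mapping_sum_single[of f] by (metis finite_keys)
qed


section \<open>Unique sums\<close>

text \<open>The unique product property of groups, written additively. It does the work of leading
  terms in products without the choice of an order on the exponents.\<close>

definition unique_sums :: "'a::plus itself \<Rightarrow> bool"
  where "unique_sums (_::'a itself) \<longleftrightarrow>
    (\<forall>A B::'a set. finite A \<longrightarrow> A \<noteq> {} \<longrightarrow> finite B \<longrightarrow> B \<noteq> {} \<longrightarrow>
      (\<exists>a\<in>A. \<exists>b\<in>B. \<forall>a'\<in>A. \<forall>b'\<in>B. a' + b' = a + b \<longrightarrow> a' = a \<and> b' = b))"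

lemma unique_sumsD:
  fixes A B :: "'a::plus set"
  assumes "unique_sums TYPE('a)" "finite A" "A \<noteq> {}" "finite B" "B \<noteq> {}"
  obtains a b where "a \<in> A" "b \<in> B" "\<And>a' b'. a' \<in> A \<Longrightarrow> b' \<in> B \<Longrightarrow> a' + b' = a + b \<Longrightarrow> a' = a \<and> b' = b"
proof -
  have "\<exists>a\<in>A. \<exists>b\<in>B. \<forall>a'\<in>A. \<forall>b'\<in>B. a' + b' = a + b \<longrightarrow> a' = a \<and> b' = b"
    using assms(1) unfolding unique_sums_def by (elim allE) (use assms(2-) in blast)
  then show thesis
    by (elim bexE) (rule that, auto)
qed

text \<open>The sum of the two maxima is unique: a smaller summand on one side cannot be compensated
  on the other.\<close>

lemma unique_sums_linordered: "unique_sums TYPE('a::linordered_ab_group_add)"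
  unfolding unique_sums_def
proof (intro allI impI)
  fix A B :: "'a set"
  assume *: "finite A" "A \<noteq> {}" "finite B" "B \<noteq> {}"
  have "a' = Max A \<and> b' = Max B" if "a' \<in> A" "b' \<in> B" "a' + b' = Max A + Max B" for a' b'
  proof -
    have "a' \<le> Max A" "b' \<le> Max B"
      using that * by auto
    then show ?thesis
      using that(3) by (metis add_le_cancel_left add_le_cancel_right order_antisym)
  qed
  then show "\<exists>a\<in>A. \<exists>b\<in>B. \<forall>a'\<in>A. \<forall>b'\<in>B. a' + b' = a + b \<longrightarrow> a' = a \<and> b' = b"
    using * Max_in by meson
qed

text \<open>One coordinate is treated at a time: a unique sum among the values of coordinate
  \<open>j\<close> selects subsets of \<open>A\<close> and \<open>B\<close>, and the remaining
  coordinates are handled inside these subsets.\<close>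

lemma unique_sums_coordinates:
  fixes c :: "'a::plus \<Rightarrow> 'k \<Rightarrow> 'b::monoid_add"
  assumes unique: "unique_sums TYPE('b)"
    and add: "\<And>x y k. c (x + y) k = c x k + c y k"
    and fin: "\<And>x. finite {k. c x k \<noteq> 0}"
    and inj: "\<And>x y. (\<And>k. c x k = c y k) \<Longrightarrow> x = y"
  shows "unique_sums TYPE('a)"
proof -
  have main: "\<exists>a\<in>A. \<exists>b\<in>B. \<forall>a'\<in>A. \<forall>b'\<in>B. (\<forall>k\<in>K. c a' k + c b' k = c a k + c b k) \<longrightarrow>
      (\<forall>k\<in>K. c a' k = c a k \<and> c b' k = c b k)"
    if "finite K" "finite A" "A \<noteq> {}" "finite B" "B \<noteq> {}" for K A B
    using that
  proof (induction K arbitrary: A B)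
    case empty
    then show ?case by auto
  next
    case (insert j K)
    obtain \<alpha> \<beta> where \<alpha>\<beta>: "\<alpha> \<in> (\<lambda>a. c a j) ` A" "\<beta> \<in> (\<lambda>b. c b j) ` B"
      "\<And>\<alpha>' \<beta>'. \<alpha>' \<in> (\<lambda>a. c a j) ` A \<Longrightarrow> \<beta>' \<in> (\<lambda>b. c b j) ` B \<Longrightarrow> \<alpha>' + \<beta>' = \<alpha> + \<beta> \<Longrightarrow> \<alpha>' = \<alpha> \<and> \<beta>' = \<beta>"
      by (rule unique_sumsD[OF unique, of "(\<lambda>a. c a j) ` A" "(\<lambda>b. c b j) ` B"])
        (use insert.prems in auto)
    let ?A = "{a \<in> A. c a j = \<alpha>}" and ?B = "{b \<in> B. c b j = \<beta>}"
    have "\<exists>a\<in>?A. \<exists>b\<in>?B. \<forall>a'\<in>?A. \<forall>b'\<in>?B. (\<forall>k\<in>K. c a' k + c b' k = c a k + c b k) \<longrightarrow>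
      (\<forall>k\<in>K. c a' k = c a k \<and> c b' k = c b k)"
      by (rule insert.IH) (use insert.prems \<alpha>\<beta>(1,2) in auto)
    then obtain a b where ab: "a \<in> ?A" "b \<in> ?B"
      "\<And>a' b'. a' \<in> ?A \<Longrightarrow> b' \<in> ?B \<Longrightarrow> (\<forall>k\<in>K. c a' k + c b' k = c a k + c b k) \<Longrightarrow>
        (\<forall>k\<in>K. c a' k = c a k \<and> c b' k = c b k)"
      by blast
    have "\<forall>k\<in>insert j K. c a' k = c a k \<and> c b' k = c b k"
      if "a' \<in> A" "b' \<in> B" "\<forall>k\<in>insert j K. c a' k + c b' k = c a k + c b k" for a' b'
    proof -
      have "c a' j = \<alpha> \<and> c b' j = \<beta>"
        using that ab(1,2) by (intro \<alpha>\<beta>(3)) auto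
      moreover from this have "\<forall>k\<in>K. c a' k = c a k \<and> c b' k = c b k"
        by (intro ab(3)) (use that in auto)
      ultimately show ?thesis
        using ab(1,2) by simp
    qed
    then show ?case
      using ab(1,2) by blast
  qed
  show ?thesis
    unfolding unique_sums_def
  proof (intro allI impI)
    fix A B :: "'a set"
    assume *: "finite A" "A \<noteq> {}" "finite B" "B \<noteq> {}"
    \<comment> \<open>Finitely many coordinates suffice: outside \<open>K\<close> every element of
      \<open>A\<close> and \<open>B\<close> has coordinate 0.\<close>
    define K where "K = (\<Union>x\<in>A \<union> B. {k. c x k \<noteq> 0})"
    have "finite K"
      using * fin by (simp add: K_def)
    obtain a b where ab: "a \<in> A" "b \<in> B"
      "\<And>a' b'. a' \<in> A \<Longrightarrow> b' \<in> B \<Longrightarrow> (\<forall>k\<in>K. c a' k + c b' k = c a k + c b k) \<Longrightarrow>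
        (\<forall>k\<in>K. c a' k = c a k \<and> c b' k = c b k)"
      using main[OF \<open>finite K\<close> *] by blast
    have "a' = a \<and> b' = b" if "a' \<in> A" "b' \<in> B" "a' + b' = a + b" for a' b'
    proof -
      have "\<forall>k\<in>K. c a' k = c a k \<and> c b' k = c b k"
        using that ab(3)[of a' b'] by (simp flip: add)
      moreover have "c x k = 0" if "x \<in> A \<union> B" "k \<notin> K" for x k
        using that by (auto simp: K_def)
      ultimately show ?thesis
        using that(1,2) ab(1,2) by (metis UnCI inj)
    qed
    then show "\<exists>a\<in>A. \<exists>b\<in>B. \<forall>a'\<in>A. \<forall>b'\<in>B. a' + b' = a + b \<longrightarrow> a' = a \<and> b' = b"
      using ab(1,2) by blast
  qed
qed

text \<open>Coordinates with respect to a Hamel basis reduce the claim to the ordered group of real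
  numbers, whatever the dimension.\<close>

lemma unique_sums_real_vector: "unique_sums TYPE('v::real_vector)"
proof -
  define B :: "'v set" where "B = extend_basis {}"
  have B: "independent B" "span B = UNIV"
    by (auto simp: B_def independent_extend_basis independent_empty span_extend_basis)
  have repr: "(\<Sum>b | representation B v b \<noteq> 0. representation B v b *\<^sub>R b) = v" for v
    by (rule sum_nonzero_representation_eq) (use B in auto)
  show ?thesis
  proof (rule unique_sums_coordinates[where c = "representation B"])
    show "unique_sums TYPE(real)"
      by (rule unique_sums_linordered)
    show "representation B (x + y) b = representation B x b + representation B y b" for x y b
      by (subst real_vector.representation_add) (auto simp: B)
    show "x = y" if "\<And>k. representation B x k = representation B y k" for x y
    proof -
      have "representation B x = representation B y"
        using that by (rule ext)
      then show ?thesis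
        by (metis repr)
    qed
  qed (rule finite_representation)
qed

lemma unique_sums_poly_mapping:
  assumes "unique_sums TYPE('v::comm_monoid_add)"
  shows "unique_sums TYPE('k \<Rightarrow>\<^sub>0 'v)"
  by (rule unique_sums_coordinates[where c = lookup, OF assms])
    (auto simp: lookup_add poly_mapping_eqI)

text \<open>The coefficient of \<open>f * g\<close> at \<open>a + b\<close> has the single
  contribution \<open>lookup f a * lookup g b\<close>, which is nonzero in a field.\<close>

lemma keys_times_unique:
  fixes f g :: "'a::comm_monoid_add \<Rightarrow>\<^sub>0 'b::field"
  assumes "\<And>a' b'. a' \<in> keys f \<Longrightarrow> b' \<in> keys g \<Longrightarrow> a' + b' = a + b \<Longrightarrow> a' = a \<and> b' = b"
    and "a \<in> keys f" "b \<in> keys g"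
  shows "a + b \<in> keys (f * g)"
proof -
  obtain f1 f2 where f: "f = f1 + f2" "keys f1 = keys f \<inter> {a}" "keys f2 = keys f - {a}"
    by (rule poly_mapping_split)
  obtain g1 g2 where g: "g = g1 + g2" "keys g1 = keys g \<inter> {b}" "keys g2 = keys g - {b}"
    by (rule poly_mapping_split)
  have "lookup f2 a = 0" "lookup g2 b = 0"
    using f(3) g(3) by (simp_all flip: not_in_keys_iff_lookup_eq_zero)
  then have 1: "f1 = single a (lookup f a)" "g1 = single b (lookup g b)"
    using poly_mapping_sum_single[of f1] poly_mapping_sum_single[of g1] assms f g
    by (auto simp: lookup_add)
  \<comment> \<open>The cross terms miss the exponent \<open>a + b\<close>: the first involves an
    exponent of \<open>f\<close> other than \<open>a\<close>, the second an exponent of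
    \<open>g\<close> other than \<open>b\<close>.\<close>
  have "a + b \<notin> keys (f2 * g)" "a + b \<notin> keys (f1 * g2)"
    using keys_mult[of f2 g] keys_mult[of f1 g2] assms(1) f g by force+
  then have "lookup (f2 * g) (a + b) = 0" "lookup (f1 * g2) (a + b) = 0"
    by (simp_all add: in_keys_iff)
  moreover have "f * g = f1 * g1 + f1 * g2 + f2 * g"
    by (simp add: f(1) g(1) algebra_simps)
  ultimately have "lookup (f * g) (a + b) = lookup (f1 * g1) (a + b)"
    by (simp add: lookup_add)
  also have "\<dots> = lookup f a * lookup g b"
    by (simp add: 1 mult_single)
  finally show ?thesis
    using assms(2,3) by (metis in_keys_iff mult_eq_0_iff)
qed

section \<open>Monomial ideals of semigroup algebras\<close>

definition monomial_span :: "'v set \<Rightarrow> ('v \<Rightarrow>\<^sub>0 'f::zero) set"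
  where "monomial_span E = {f. keys f \<subseteq> E}"

definition semigroup_ideal :: "'v::plus set \<Rightarrow> 'v set \<Rightarrow> bool"
  where "semigroup_ideal S E \<longleftrightarrow> E \<subseteq> S \<and> (\<forall>a\<in>E. \<forall>b\<in>S. a + b \<in> E)"

text \<open>For a submonoid \<open>S\<close> these are the complements of faces. The choice
  \<open>E = {}\<close>, the complement of the face \<open>S\<close>, corresponds to the zero
  ideal.\<close>

definition prime_semigroup_ideal :: "'v::plus set \<Rightarrow> 'v set \<Rightarrow> bool"
  where "prime_semigroup_ideal S E \<longleftrightarrow>
    semigroup_ideal S E \<and> E \<noteq> S \<and> (\<forall>a\<in>S. \<forall>b\<in>S. a + b \<in> E \<longrightarrow> a \<in> E \<or> b \<in> E)"

text \<open>Starting from \<open>S\<close> instead of \<open>{0}\<close> matches the convention that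
  the zeroth power of an ideal is the whole ring.\<close>

primrec semigroup_power :: "'v::plus set \<Rightarrow> 'v set \<Rightarrow> nat \<Rightarrow> 'v set"
  where "semigroup_power S E 0 = S"
  | "semigroup_power S E (Suc r) = {a + b | a b. a \<in> semigroup_power S E r \<and> b \<in> E}"

definition semigroup_symbolic_power :: "'v::plus set \<Rightarrow> 'v set \<Rightarrow> nat \<Rightarrow> 'v set"
  where "semigroup_symbolic_power S E r = {t \<in> S. \<exists>u\<in>S - E. u + t \<in> semigroup_power S E r}"

lemma monomial_span_mono: "E \<subseteq> E' \<Longrightarrow> monomial_span E \<subseteq> monomial_span E'"
  by (auto simp: monomial_span_def)

lemma monomial_span_subset_iff:
  "monomial_span E \<subseteq> (monomial_span E' :: ('v \<Rightarrow>\<^sub>0 'f::zero_neq_one) set) \<longleftrightarrow> E \<subseteq> E'"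
proof
  assume sub: "monomial_span E \<subseteq> (monomial_span E' :: ('v \<Rightarrow>\<^sub>0 'f) set)"
  show "E \<subseteq> E'"
  proof
    fix m
    assume "m \<in> E"
    then have "single m 1 \<in> (monomial_span E :: ('v \<Rightarrow>\<^sub>0 'f) set)"
      by (simp add: monomial_span_def)
    then have "single m 1 \<in> (monomial_span E' :: ('v \<Rightarrow>\<^sub>0 'f) set)"
      using sub by blast
    then show "m \<in> E'"
      by (simp add: monomial_span_def)
  qed
qed (rule monomial_span_mono)

lemma monomial_span_add: "f \<in> monomial_span E \<Longrightarrow> g \<in> monomial_span E \<Longrightarrow> f + g \<in> monomial_span E"
  unfolding monomial_span_def using Poly_Mapping.keys_add[of f g] by auto

lemma monomial_span_uminus:
  fixes f :: "'v \<Rightarrow>\<^sub>0 'f::ab_group_add"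
  shows "f \<in> monomial_span E \<Longrightarrow> - f \<in> monomial_span E"
  by (auto simp: monomial_span_def in_keys_iff)

lemma monomial_span_diff:
  fixes f g :: "'v \<Rightarrow>\<^sub>0 'f::ab_group_add"
  shows "f \<in> monomial_span E \<Longrightarrow> g \<in> monomial_span E \<Longrightarrow> f - g \<in> monomial_span E"
  using monomial_span_add[OF _ monomial_span_uminus] by fastforce

lemma monomial_span_times:
  fixes f g :: "'v::comm_monoid_add \<Rightarrow>\<^sub>0 'f::comm_ring_1"
  assumes "f \<in> monomial_span E" "g \<in> monomial_span E'" "\<And>a b. a \<in> E \<Longrightarrow> b \<in> E' \<Longrightarrow> a + b \<in> E''"
  shows "f * g \<in> monomial_span E''"
  using assms keys_mult[of f g] unfolding monomial_span_def by blast

lemma monomial_span_scale: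
  fixes f :: "'v::comm_monoid_add \<Rightarrow>\<^sub>0 'f::comm_ring_1"
  shows "f \<in> monomial_span E \<Longrightarrow> single 0 c * f \<in> monomial_span E"
  using monomial_span_times[of "single 0 c" "{0}" f E E] by (auto simp: monomial_span_def)

lemma monomial_span_zero [simp]: "0 \<in> monomial_span E"
  by (simp add: monomial_span_def)

lemma monomial_span_single: "k \<in> E \<Longrightarrow> single k c \<in> monomial_span E"
  by (simp add: monomial_span_def)

lemma monomial_span_singleD: "single k c \<in> monomial_span E \<Longrightarrow> c \<noteq> 0 \<Longrightarrow> k \<in> E"
  by (simp add: monomial_span_def)

lemma semigroup_algebra_simps [simp]:
  "carrier (semigroup_algebra S) = monomial_span S"
  "f \<otimes>\<^bsub>semigroup_algebra S\<^esub> g = f * g"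
  "f \<oplus>\<^bsub>semigroup_algebra S\<^esub> g = f + g"
  "\<one>\<^bsub>semigroup_algebra S\<^esub> = 1"
  "\<zero>\<^bsub>semigroup_algebra S\<^esub> = 0"
  "c \<odot>\<^bsub>semigroup_algebra S\<^esub> f = single 0 c * f"
  by (simp_all add: semigroup_algebra_def monomial_span_def)

text \<open>The annihilator of the class of \<open>x\<close> is \<open>P\<close> if \<open>x\<close>
  lies outside \<open>P\<close>, and otherwise the whole ring, which is not prime. The class of
  \<open>\<one>\<close> shows that \<open>P\<close> itself occurs.\<close>

lemma (in cring) associated_primes_primeideal:
  assumes "primeideal P R"
  shows "associated_primes R P = {P}"
proof -
  interpret primeideal P R by (rule assms)
  have 1: "{a \<in> carrier R. a \<otimes> x \<in> P} = P" if "x \<in> carrier R" "x \<notin> P" for x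
    using that I_prime I_r_closed Icarr by blast
  have 2: "{a \<in> carrier R. a \<otimes> x \<in> P} = carrier R" if "x \<in> P" for x
    using that I_l_closed by blast
  have 3: "\<not> primeideal (carrier R) R"
    using primeideal.I_notcarr by blast
  have 4: "\<one> \<notin> P"
    using I_notcarr one_imp_carrier by blast
  show ?thesis
    unfolding associated_primes_def
  proof (intro subset_antisym subsetI)
    fix P'
    assume "P' \<in> {P'. primeideal P' R \<and> (\<exists>x\<in>carrier R. P' = {a \<in> carrier R. a \<otimes> x \<in> P})}"
    then obtain x where x: "primeideal P' R" "x \<in> carrier R" "P' = {a \<in> carrier R. a \<otimes> x \<in> P}"
      by blast
    show "P' \<in> {P}"
      using x 1[of x] 2[of x] 3 by (cases "x \<in> P") simp_all
  next
    fix P'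
    assume "P' \<in> {P}"
    then show "P' \<in> {P'. primeideal P' R \<and> (\<exists>x\<in>carrier R. P' = {a \<in> carrier R. a \<otimes> x \<in> P})}"
      using assms 1[OF one_closed 4] by (auto intro!: bexI[of _ \<one>])
  qed
qed

lemma (in cring) symbolic_power_primeideal:
  assumes "primeideal P R"
  shows "symbolic_power R P a = {f \<in> carrier R. \<exists>s\<in>carrier R - P. s \<otimes> f \<in> ideal_power R P a}"
  unfolding symbolic_power_def by (simp add: associated_primes_primeideal[OF assms])

lemma ideal_power_0: "ideal_power R I 0 = carrier R"
  by (simp add: ideal_power_def ideals_set_def)

lemma ideal_power_Suc: "ideal_power R I (Suc r) = ideal_prod R (ideal_power R I r) I"
  by (simp add: ideal_power_def nat_pow_Suc) (simp add: ideals_set_def)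

locale additive_submonoid =
  fixes S :: "'v::comm_monoid_add set"
  assumes zero_mem: "0 \<in> S" and add_mem: "a \<in> S \<Longrightarrow> b \<in> S \<Longrightarrow> a + b \<in> S"
begin

lemma cring_semigroup_algebra: "cring (semigroup_algebra S :: ('f::field, 'v \<Rightarrow>\<^sub>0 'f) module)"
proof (rule cringI)
  show "abelian_group (semigroup_algebra S :: ('f, 'v \<Rightarrow>\<^sub>0 'f) module)"
  proof (rule abelian_groupI; simp)
    show "\<exists>y\<in>monomial_span S. y + x = 0" if "x \<in> monomial_span S" for x :: "'v \<Rightarrow>\<^sub>0 'f"
      using that by (intro bexI[of _ "- x"]) (auto intro: monomial_span_uminus)
  qed (auto simp: add.assoc add.commute monomial_span_add)
  show "Group.comm_monoid (semigroup_algebra S :: ('f, 'v \<Rightarrow>\<^sub>0 'f) module)"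
    by (rule Group.comm_monoidI; simp)
      (auto simp: mult.assoc mult.commute intro: monomial_span_times[OF _ _ add_mem]
        simp flip: single_one intro!: monomial_span_single zero_mem)
qed (simp add: algebra_simps)

lemma semigroup_ideal_subset: "semigroup_ideal S E \<Longrightarrow> E \<subseteq> S"
  by (simp add: semigroup_ideal_def)

lemma semigroup_idealD:
  "semigroup_ideal S E \<Longrightarrow> a \<in> E \<Longrightarrow> b \<in> S \<Longrightarrow> a + b \<in> E"
  "semigroup_ideal S E \<Longrightarrow> a \<in> S \<Longrightarrow> b \<in> E \<Longrightarrow> a + b \<in> E"
  by (auto simp: semigroup_ideal_def add.commute)

lemma ideal_monomial_span:
  assumes "semigroup_ideal S E"
  shows "ideal (monomial_span E) (semigroup_algebra S :: ('f::field, 'v \<Rightarrow>\<^sub>0 'f) module)"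
proof -
  interpret A: cring "semigroup_algebra S :: ('f, 'v \<Rightarrow>\<^sub>0 'f) module"
    by (rule cring_semigroup_algebra)
  show ?thesis
  proof (rule idealI[OF A.ring_axioms group.subgroupI[OF A.a_group]], fold a_inv_def, simp_all)
    show "monomial_span E \<subseteq> (monomial_span S :: ('v \<Rightarrow>\<^sub>0 'f) set)"
      using semigroup_ideal_subset[OF assms] by (auto simp: monomial_span_def)
    show "monomial_span E \<noteq> ({} :: ('v \<Rightarrow>\<^sub>0 'f) set)"
      using monomial_span_zero by blast
    show "\<ominus>\<^bsub>semigroup_algebra S\<^esub> f \<in> monomial_span E"
      if "f \<in> monomial_span E" for f :: "'v \<Rightarrow>\<^sub>0 'f"
    proof -
      have "f \<in> monomial_span S"
        using that semigroup_ideal_subset[OF assms] by (auto simp: monomial_span_def)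
      then have "\<ominus>\<^bsub>semigroup_algebra S\<^esub> f = - f"
        by (intro A.minus_equality) (auto intro: monomial_span_uminus)
      then show ?thesis
        using that by (simp add: monomial_span_uminus)
    qed
  qed (use assms in \<open>auto intro: monomial_span_add monomial_span_times semigroup_idealD\<close>)
qed

lemma monomial_span_ideal_times:
  fixes f g :: "'v \<Rightarrow>\<^sub>0 'f::field"
  assumes "semigroup_ideal S E"
  shows "f \<in> monomial_span E \<Longrightarrow> keys g \<subseteq> S \<Longrightarrow> f * g \<in> monomial_span E"
    and "keys f \<subseteq> S \<Longrightarrow> g \<in> monomial_span E \<Longrightarrow> f * g \<in> monomial_span E"
  using monomial_span_times[of f E g S E] monomial_span_times[of f S g E E] semigroup_idealD[OF assms]
  by (auto simp: monomial_span_def[of S])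

text \<open>A term with exponent \<open>b + s\<close> is the generator at \<open>b\<close> times a
  term at \<open>s\<close>. Conversely, the span of \<open>E\<close> is an ideal containing the
  generators.\<close>

lemma genideal_monomials:
  assumes "semigroup_ideal S E" "B \<subseteq> E" "\<And>e. e \<in> E \<Longrightarrow> \<exists>b\<in>B. \<exists>s\<in>S. e = b + s"
  shows "Idl\<^bsub>semigroup_algebra S\<^esub> (monomials B) = (monomial_span E :: ('v \<Rightarrow>\<^sub>0 'f::field) set)"
proof -
  interpret A: cring "semigroup_algebra S :: ('f, 'v \<Rightarrow>\<^sub>0 'f) module"
    by (rule cring_semigroup_algebra)
  have sub: "monomials B \<subseteq> (monomial_span E :: ('v \<Rightarrow>\<^sub>0 'f) set)"
    using assms(2) by (auto simp: monomials_def monomial_span_def)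
  moreover have "monomial_span E \<subseteq> (monomial_span S :: ('v \<Rightarrow>\<^sub>0 'f) set)"
    using semigroup_ideal_subset[OF assms(1)] by (auto simp: monomial_span_def)
  ultimately have carrier: "monomials B \<subseteq> carrier (semigroup_algebra S :: ('f, 'v \<Rightarrow>\<^sub>0 'f) module)"
    by simp
  interpret J: ideal "Idl\<^bsub>semigroup_algebra S\<^esub> (monomials B :: ('v \<Rightarrow>\<^sub>0 'f) set)"
      "semigroup_algebra S :: ('f, 'v \<Rightarrow>\<^sub>0 'f) module"
    by (rule A.genideal_ideal[OF carrier])
  have "f \<in> Idl\<^bsub>semigroup_algebra S\<^esub> (monomials B)" if "keys f \<subseteq> E" for f :: "'v \<Rightarrow>\<^sub>0 'f"
    using that
  proof (induction f rule: poly_mapping_additive_induct)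
    case zero
    show ?case
      using J.zero_closed by simp
  next
    case (single k c)
    then obtain b s where b: "b \<in> B" "s \<in> S" "k = b + s"
      using assms(3) by blast
    have "single b 1 \<in> Idl\<^bsub>semigroup_algebra S\<^esub> (monomials B :: ('v \<Rightarrow>\<^sub>0 'f) set)"
      using A.genideal_self[OF carrier] b(1) by (auto simp: monomials_def)
    from J.I_r_closed[OF this, of "single s c"] show ?case
      using b by (simp add: mult_single monomial_span_single)
  next
    case (add f g)
    then show ?case
      using J.a_closed by simp
  qed
  moreover have "Idl\<^bsub>semigroup_algebra S\<^esub> (monomials B) \<subseteq> (monomial_span E :: ('v \<Rightarrow>\<^sub>0 'f) set)"
    using A.genideal_minimal[OF ideal_monomial_span[OF assms(1)] sub] .
  ultimately show ?thesis
    by (auto simp: monomial_span_def)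
qed

text \<open>Once the parts inside \<open>E\<close> are removed from \<open>f\<close> and
  \<open>g\<close>, both remainders have their exponents outside \<open>E\<close>. If both are
  nonzero, an exponent \<open>a + b\<close> with a unique decomposition survives in their product
  and contradicts the primality of \<open>E\<close>.\<close>

lemma primeideal_monomial_span:
  assumes "unique_sums TYPE('v)" "prime_semigroup_ideal S E"
  shows "primeideal (monomial_span E) (semigroup_algebra S :: ('f::field, 'v \<Rightarrow>\<^sub>0 'f) module)"
proof (rule primeidealI)
  have E: "semigroup_ideal S E" "E \<noteq> S" "\<And>a b. a \<in> S \<Longrightarrow> b \<in> S \<Longrightarrow> a + b \<in> E \<Longrightarrow> a \<in> E \<or> b \<in> E"
    using assms(2) by (auto simp: prime_semigroup_ideal_def)
  show "ideal (monomial_span E) (semigroup_algebra S :: ('f, 'v \<Rightarrow>\<^sub>0 'f) module)"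
    by (rule ideal_monomial_span[OF E(1)])
  obtain a where a: "a \<in> S" "a \<notin> E"
    using E(1,2) by (auto simp: semigroup_ideal_def)
  then have "single a 1 \<in> monomial_span S" "single a 1 \<notin> (monomial_span E :: ('v \<Rightarrow>\<^sub>0 'f) set)"
    by (auto simp: monomial_span_def)
  then show "carrier (semigroup_algebra S :: ('f, 'v \<Rightarrow>\<^sub>0 'f) module) \<noteq> monomial_span E"
    by auto
  fix f g :: "'v \<Rightarrow>\<^sub>0 'f"
  assume fg: "f \<in> carrier (semigroup_algebra S)" "g \<in> carrier (semigroup_algebra S)"
    "f \<otimes>\<^bsub>semigroup_algebra S\<^esub> g \<in> monomial_span E"
  show "f \<in> monomial_span E \<or> g \<in> monomial_span E"
  proof (rule ccontr)
    assume neg: "\<not> (f \<in> monomial_span E \<or> g \<in> monomial_span E)"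
    obtain f1 f2 where f: "f = f1 + f2" "keys f1 = keys f \<inter> E" "keys f2 = keys f - E"
      by (rule poly_mapping_split)
    obtain g1 g2 where g: "g = g1 + g2" "keys g1 = keys g \<inter> E" "keys g2 = keys g - E"
      by (rule poly_mapping_split)
    have "f1 \<in> monomial_span E" "g1 \<in> monomial_span E" "keys g \<subseteq> S" "keys f2 \<subseteq> S"
      using fg(1,2) f(2,3) g(2) by (auto simp: monomial_span_def)
    then have "f1 * g \<in> monomial_span E" "f2 * g1 \<in> monomial_span E"
      by (auto intro: monomial_span_ideal_times[OF E(1)])
    then have "f * g - f1 * g - f2 * g1 \<in> monomial_span E"
      using fg(3) by (intro monomial_span_diff) auto
    then have *: "f2 * g2 \<in> monomial_span E"
      by (simp add: f(1) g(1) algebra_simps)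
    have "keys f2 \<noteq> {}" "keys g2 \<noteq> {}"
      using neg f(3) g(3) by (auto simp: monomial_span_def)
    then obtain a b where ab: "a \<in> keys f2" "b \<in> keys g2"
      "\<And>a' b'. a' \<in> keys f2 \<Longrightarrow> b' \<in> keys g2 \<Longrightarrow> a' + b' = a + b \<Longrightarrow> a' = a \<and> b' = b"
      using unique_sumsD[OF assms(1), of "keys f2" "keys g2"] finite_keys by metis
    have "a + b \<in> keys (f2 * g2)"
      by (rule keys_times_unique[OF ab(3,1,2)])
    then have "a + b \<in> E"
      using * by (auto simp: monomial_span_def)
    then show False
      using E(3)[of a b] ab(1,2) f(3) g(3) fg(1,2) by (auto simp: monomial_span_def)
  qed
qed (rule cring_semigroup_algebra)

lemma monomial_primeI:
  assumes "unique_sums TYPE('v)" "prime_semigroup_ideal S E"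
  shows "monomial_prime (semigroup_algebra S) (monomials S) (monomial_span E :: ('v \<Rightarrow>\<^sub>0 'f::field) set)"
  unfolding monomial_prime_def
proof (intro conjI exI[of _ "monomials E"])
  have E: "semigroup_ideal S E"
    using assms(2) by (simp add: prime_semigroup_ideal_def)
  show "primeideal (monomial_span E) (semigroup_algebra S :: ('f::field, 'v \<Rightarrow>\<^sub>0 'f) module)"
    by (rule primeideal_monomial_span[OF assms])
  show "monomials E \<subseteq> (monomials S :: ('v \<Rightarrow>\<^sub>0 'f) set)"
    using semigroup_ideal_subset[OF E] by (auto simp: monomials_def)
  show "(monomial_span E :: ('v \<Rightarrow>\<^sub>0 'f) set) = Idl\<^bsub>semigroup_algebra S\<^esub> (monomials E)"
    using zero_mem by (intro genideal_monomials[symmetric] E) (simp, metis add_0_right)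
qed

text \<open>The translates by \<open>S\<close> of the exponents of the generators form
  \<open>E\<close>. Primality of \<open>P\<close>, tested on pairs of monomials, makes
  \<open>E\<close> prime.\<close>

lemma monomial_primeE:
  fixes P :: "('v \<Rightarrow>\<^sub>0 'f::field) set"
  assumes "monomial_prime (semigroup_algebra S) (monomials S) P"
  obtains E where "prime_semigroup_ideal S E" "P = monomial_span E"
proof -
  obtain C where C: "primeideal P (semigroup_algebra S)" "C \<subseteq> monomials S"
    "P = Idl\<^bsub>semigroup_algebra S\<^esub> C"
    using assms by (auto simp: monomial_prime_def)
  define B where "B = {b \<in> S. single b 1 \<in> C}"
  define E where "E = {b + s | b s. b \<in> B \<and> s \<in> S}"
  have CB: "C = monomials B"
    using C(2) by (auto simp: monomials_def B_def)
  have E: "semigroup_ideal S E"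
    unfolding semigroup_ideal_def E_def B_def by (force intro: add_mem simp: add.assoc)
  have P: "P = monomial_span E"
    unfolding C(3) CB
  proof (rule genideal_monomials[OF E])
    show "B \<subseteq> E"
      using zero_mem by (force simp: E_def)
  qed (auto simp: E_def)
  interpret primeideal P "semigroup_algebra S"
    by (rule C(1))
  have "a \<in> E \<or> b \<in> E" if "a \<in> S" "b \<in> S" "a + b \<in> E" for a b
    using I_prime[of "single a 1" "single b 1"] that
    by (auto simp: P mult_single monomial_span_single dest: monomial_span_singleD)
  moreover have "E \<noteq> S"
    using I_notcarr by (auto simp: P)
  ultimately have "prime_semigroup_ideal S E"
    using E by (simp add: prime_semigroup_ideal_def)
  then show thesis
    using P by (rule that)
qed

section \<open>Powers and symbolic powers of monomial ideals\<close>

lemma semigroup_ideal_sum: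
  assumes "semigroup_ideal S E" "semigroup_ideal S E'"
  shows "semigroup_ideal S {a + b | a b. a \<in> E \<and> b \<in> E'}"
  using assms unfolding semigroup_ideal_def
  by (safe, blast intro: add_mem) (metis add.assoc)

lemma semigroup_ideal_power: "semigroup_ideal S E \<Longrightarrow> semigroup_ideal S (semigroup_power S E r)"
  by (induction r) (auto intro: semigroup_ideal_sum, auto simp: semigroup_ideal_def add_mem)

lemma ideal_prod_monomial_span:
  "ideal_prod (semigroup_algebra S) (monomial_span E) (monomial_span E') =
    (monomial_span {a + b | a b. a \<in> E \<and> b \<in> E'} :: ('v \<Rightarrow>\<^sub>0 'f::field) set)" (is "?L = ?R")
proof
  show "?L \<subseteq> ?R"
  proof
    fix f
    assume "f \<in> ?L"
    then show "f \<in> ?R"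
    proof (induction f rule: ideal_prod.induct)
      case (prod i j)
      then show ?case
        by (auto intro: monomial_span_times)
    qed (simp add: monomial_span_add)
  qed
  show "?R \<subseteq> ?L"
  proof
    fix f
    assume "f \<in> ?R"
    then have "keys f \<subseteq> {a + b | a b. a \<in> E \<and> b \<in> E'}"
      by (simp add: monomial_span_def)
    then show "f \<in> ?L"
    proof (induction f rule: poly_mapping_additive_induct)
      case zero
      \<comment> \<open>Zero enters \<open>ideal_prod\<close> as the product
        \<open>0 * 0\<close>.\<close>
      show ?case
        using ideal_prod.prod[OF monomial_span_zero monomial_span_zero, of "semigroup_algebra S"] by simp
    next
      case (single k c)
      then obtain a b where "a \<in> E" "b \<in> E'" "k = a + b"
        by auto
      then show ?case
        using ideal_prod.prod[of "single a c" "monomial_span E" "single b 1" "monomial_span E'" "semigroup_algebra S"]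
        by (simp add: mult_single monomial_span_single)
    next
      case (add f g)
      then show ?case
        using ideal_prod.sum[of f "semigroup_algebra S"] by simp
    qed
  qed
qed

lemma ideal_power_monomial_span:
  "ideal_power (semigroup_algebra S) (monomial_span E) r =
    (monomial_span (semigroup_power S E r) :: ('v \<Rightarrow>\<^sub>0 'f::field) set)"
  by (induction r) (simp_all add: ideal_power_0 ideal_power_Suc ideal_prod_monomial_span)

lemma semigroup_ideal_symbolic_power:
  assumes "semigroup_ideal S E"
  shows "semigroup_ideal S (semigroup_symbolic_power S E r)"
  using semigroup_ideal_power[OF assms, of r]
  unfolding semigroup_ideal_def semigroup_symbolic_power_def
  by (auto intro: add_mem) (metis DiffI add.assoc)

text \<open>An element supported on the face is a nonzerodivisor modulo the symbolic power.
  Otherwise a uniquely decomposed exponent \<open>u + t\<close> with \<open>u\<close> in the face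
  would lie in the symbolic power while \<open>t\<close> does not.\<close>

lemma face_cancel:
  fixes s g :: "'v \<Rightarrow>\<^sub>0 'f::field"
  assumes "unique_sums TYPE('v)" "prime_semigroup_ideal S E"
    and s: "keys s \<subseteq> S - E" "s \<noteq> 0" and g: "keys g \<subseteq> S"
    and sg: "s * g \<in> monomial_span (semigroup_symbolic_power S E r)"
  shows "g \<in> monomial_span (semigroup_symbolic_power S E r)"
proof (rule ccontr)
  let ?K = "semigroup_symbolic_power S E r"
  assume neg: "g \<notin> monomial_span ?K"
  have E: "semigroup_ideal S E" "\<And>a b. a \<in> S \<Longrightarrow> b \<in> S \<Longrightarrow> a + b \<in> E \<Longrightarrow> a \<in> E \<or> b \<in> E"
    using assms(2) by (auto simp: prime_semigroup_ideal_def)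
  have K: "semigroup_ideal S ?K"
    by (rule semigroup_ideal_symbolic_power[OF E(1)])
  obtain g1 g2 where g12: "g = g1 + g2" "keys g1 = keys g \<inter> ?K" "keys g2 = keys g - ?K"
    by (rule poly_mapping_split)
  have "s * g1 \<in> monomial_span ?K"
    using s(1) g12(2) by (intro monomial_span_ideal_times[OF K]) (auto simp: monomial_span_def)
  then have "s * g - s * g1 \<in> monomial_span ?K"
    by (intro monomial_span_diff sg)
  then have *: "s * g2 \<in> monomial_span ?K"
    by (simp add: g12(1) algebra_simps)
  have "keys s \<noteq> {}" "keys g2 \<noteq> {}"
    using neg s g12(3) by (auto simp: monomial_span_def)
  then obtain u t where ut: "u \<in> keys s" "t \<in> keys g2"
    "\<And>a' b'. a' \<in> keys s \<Longrightarrow> b' \<in> keys g2 \<Longrightarrow> a' + b' = u + t \<Longrightarrow> a' = u \<and> b' = t"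
    using unique_sumsD[OF assms(1), of "keys s" "keys g2"] finite_keys by metis
  have "u + t \<in> keys (s * g2)"
    by (rule keys_times_unique[OF ut(3,1,2)])
  then have "u + t \<in> ?K"
    using * by (auto simp: monomial_span_def)
  then obtain u' where "u' \<in> S - E" "u' + (u + t) \<in> semigroup_power S E r"
    by (auto simp: semigroup_symbolic_power_def)
  \<comment> \<open>The complement of a prime ideal is closed under addition, so
    \<open>u' + u\<close> is an admissible multiplier for \<open>t\<close>.\<close>
  then have "u' + u \<in> S - E" "(u' + u) + t \<in> semigroup_power S E r"
    using E(2)[of u' u] s(1) ut(1) by (auto simp: add.assoc intro: add_mem)
  then have "t \<in> ?K"
    using g g12(3) ut(2) by (auto simp: semigroup_symbolic_power_def)
  then show False
    using g12(3) ut(2) by simp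
qed

text \<open>From left to right, the multiplier is reduced to its part on the face, which can be
  cancelled. From right to left, one multiplier has to serve all exponents of \<open>f\<close> at
  once.\<close>

lemma symbolic_power_monomial_span:
  assumes "unique_sums TYPE('v)" "prime_semigroup_ideal S E"
  shows "symbolic_power (semigroup_algebra S) (monomial_span E) r =
    (monomial_span (semigroup_symbolic_power S E r) :: ('v \<Rightarrow>\<^sub>0 'f::field) set)" (is "?L = ?R")
proof
  let ?K = "semigroup_symbolic_power S E r"
  have E: "semigroup_ideal S E" "E \<noteq> S" "\<And>a b. a \<in> S \<Longrightarrow> b \<in> S \<Longrightarrow> a + b \<in> E \<Longrightarrow> a \<in> E \<or> b \<in> E"
    using assms(2) by (auto simp: prime_semigroup_ideal_def)
  have K: "semigroup_ideal S ?K"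
    by (rule semigroup_ideal_symbolic_power[OF E(1)])
  have zero_face: "0 \<in> S - E"
    using E(1,2) zero_mem unfolding semigroup_ideal_def by (metis DiffI add_0 subset_antisym subset_eq)
  have power_K: "semigroup_power S E r \<subseteq> ?K"
    using semigroup_ideal_subset[OF semigroup_ideal_power[OF E(1), of r]]
    unfolding semigroup_symbolic_power_def by (auto intro!: bexI[OF _ zero_face])
  have L: "?L = {f \<in> monomial_span S. \<exists>s\<in>monomial_span S - monomial_span E. s * f \<in> monomial_span (semigroup_power S E r)}"
    using cring.symbolic_power_primeideal[OF cring_semigroup_algebra primeideal_monomial_span[OF assms]]
    by (simp add: ideal_power_monomial_span)
  show "?L \<subseteq> ?R"
  proof
    fix f
    assume "f \<in> ?L"
    then obtain s where f: "keys f \<subseteq> S" and s: "keys s \<subseteq> S" "\<not> keys s \<subseteq> E"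
      and "s * f \<in> monomial_span (semigroup_power S E r)"
      unfolding L by (auto simp: monomial_span_def)
    then have sf: "s * f \<in> monomial_span ?K"
      using power_K monomial_span_mono by blast
    note K_times = monomial_span_ideal_times(2)[OF K]
    have S_power: "keys (a ^ k) \<subseteq> S" if "keys a \<subseteq> S" for a :: "'v \<Rightarrow>\<^sub>0 'f" and k
    proof (induction k)
      case (Suc k)
      have "a ^ Suc k \<in> monomial_span S"
        by (simp, rule monomial_span_times[where E = S and E' = S])
          (use Suc that in \<open>auto simp: monomial_span_def intro: add_mem\<close>)
      then show ?case
        by (simp add: monomial_span_def)
    qed (simp add: zero_mem)
    obtain s2 s1 where s12: "s = s2 + s1" "keys s2 = keys s \<inter> E" "keys s1 = keys s - E"
      by (rule poly_mapping_split)
    \<comment> \<open>Since \<open>s = s2 + s1\<close> and \<open>s * f\<close> lies in the span of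
      \<open>?K\<close>, multiplication by \<open>s1\<close> and by \<open>- s2\<close> have the
      same effect on multiples of \<open>f\<close> modulo that span.\<close>
    have cong: "s1 ^ k * f - (- s2) ^ k * f \<in> monomial_span ?K" for k
    proof (induction k)
      case (Suc k)
      have "s1 * (s1 ^ k * f - (- s2) ^ k * f) + (- s2) ^ k * (s * f) \<in> monomial_span ?K"
        using s s12 by (intro monomial_span_add K_times Suc S_power sf) auto
      then show ?case
        by (simp add: s12(1) algebra_simps)
    qed simp
    have "(- s2) ^ k \<in> monomial_span (semigroup_power S E k)" for k
    proof (induction k)
      case 0
      show ?case
        by (simp add: monomial_span_def zero_mem)
    next
      case (Suc k)
      have "- s2 \<in> monomial_span E"
        using s12(2) by (intro monomial_span_uminus) (auto simp: monomial_span_def)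
      from monomial_span_times[OF Suc this, of "semigroup_power S E (Suc k)"] show ?case
        by (auto simp: mult.commute)
    qed
    from this[of r] have "(- s2) ^ r \<in> monomial_span ?K"
      using power_K monomial_span_mono by blast
    from K_times[OF f this] have "(- s2) ^ r * f \<in> monomial_span ?K"
      by (simp add: mult.commute)
    from monomial_span_add[OF cong[of r] this] have nilpotent: "s1 ^ r * f \<in> monomial_span ?K"
      by simp
    have "s1 \<noteq> 0" "keys s1 \<subseteq> S - E"
      using s s12(3) by auto
    \<comment> \<open>The factors \<open>s1\<close> are cancelled one at a time.\<close>
    have "f \<in> monomial_span ?K" if "s1 ^ k * f \<in> monomial_span ?K" for k
      using that
    proof (induction k)
      case (Suc k)
      have "keys (s1 ^ k * f) \<subseteq> S"
        using keys_mult[of "s1 ^ k" f] S_power[of s1 k] f add_mem \<open>keys s1 \<subseteq> S - E\<close> by blast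
      then show ?case
        using face_cancel[OF assms \<open>keys s1 \<subseteq> S - E\<close> \<open>s1 \<noteq> 0\<close>, of "s1 ^ k * f" r] Suc
        by (simp add: mult.assoc)
    qed simp
    then show "f \<in> ?R"
      using nilpotent by blast
  qed
  show "?R \<subseteq> ?L"
  proof
    fix f
    assume f: "f \<in> ?R"
    \<comment> \<open>A common multiplier for finitely many exponents is the sum of their individual
      multipliers; by primality it stays outside \<open>E\<close>.\<close>
    have "\<exists>u\<in>S - E. \<forall>t\<in>T. u + t \<in> semigroup_power S E r" if "finite T" "T \<subseteq> ?K" for T
      using that
    proof (induction T)
      case empty
      show ?case
        using zero_face by auto
    next
      case (insert t T)
      then obtain u v where "u \<in> S - E" "\<forall>t\<in>T. u + t \<in> semigroup_power S E r"
        "v \<in> S - E" "v + t \<in> semigroup_power S E r"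
        by (auto simp: semigroup_symbolic_power_def)
      moreover from this have "u + v \<in> S - E"
        using E(3) by (auto intro: add_mem)
      ultimately show ?case
        using semigroup_idealD[OF semigroup_ideal_power[OF E(1), of r]]
        by (intro bexI[of _ "u + v"]) (auto simp: add.assoc, metis add.commute add.left_commute)
    qed
    from this[of "keys f"] f obtain u where u: "u \<in> S - E" "\<forall>t\<in>keys f. u + t \<in> semigroup_power S E r"
      by (auto simp: monomial_span_def)
    have "single u 1 * f \<in> monomial_span (semigroup_power S E r)"
      using u(2) by (intro monomial_span_times[where E = "{u}" and E' = "keys f"]) (auto simp: monomial_span_def)
    moreover have "f \<in> monomial_span S"
      using f K by (auto simp: monomial_span_def semigroup_ideal_def)
    moreover have "single u 1 \<in> monomial_span S - (monomial_span E :: ('v \<Rightarrow>\<^sub>0 'f) set)"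
      using u(1) by (auto simp: monomial_span_def)
    ultimately show "f \<in> ?L"
      unfolding L by blast
  qed
qed

end

section \<open>Products of semigroups\<close>

context additive_submonoid
begin

lemma sum_mem: "(\<And>i. i \<in> I \<Longrightarrow> x i \<in> S) \<Longrightarrow> sum x I \<in> S"
  by (induction I rule: infinite_finite_induct) (auto intro: zero_mem add_mem)

lemma semigroup_power_antimono:
  assumes "semigroup_ideal S E" "m \<le> n"
  shows "semigroup_power S E n \<subseteq> semigroup_power S E m"
  using assms(2)
proof (rule lift_Suc_antimono_le[rotated])
  show "semigroup_power S E (Suc k) \<subseteq> semigroup_power S E k" for k
    using semigroup_idealD(1)[OF semigroup_ideal_power[OF assms(1)]] semigroup_ideal_subset[OF assms(1)]
    by auto
qed

lemma semigroup_power_add: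
  assumes "semigroup_ideal S E" "a \<in> semigroup_power S E m" "b \<in> semigroup_power S E n"
  shows "a + b \<in> semigroup_power S E (m + n)"
  using assms(3)
proof (induction n arbitrary: b)
  case 0
  then show ?case
    using semigroup_idealD(1)[OF semigroup_ideal_power[OF assms(1)]] assms(2) by simp
next
  case (Suc n)
  then obtain c d where "c \<in> semigroup_power S E n" "d \<in> E" "b = c + d"
    by auto
  then show ?case
    using Suc.IH[of c] by (auto simp flip: add.assoc)
qed

lemma semigroup_power_sum:
  assumes "semigroup_ideal S E" "finite I" "\<And>i. i \<in> I \<Longrightarrow> x i \<in> semigroup_power S E (r i)"
  shows "sum x I \<in> semigroup_power S E (sum r I)"
  using assms(2,3) by (induction I) (simp_all add: zero_mem semigroup_power_add[OF assms(1)])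

lemma prime_semigroup_ideal_zero_notin: "prime_semigroup_ideal S E \<Longrightarrow> 0 \<notin> E"
  unfolding prime_semigroup_ideal_def semigroup_ideal_def by (metis add_0 subset_antisym subsetI)

lemma prime_semigroup_ideal_sum:
  assumes "prime_semigroup_ideal S E" "finite I" "\<And>i. i \<in> I \<Longrightarrow> x i \<in> S" "sum x I \<in> E"
  shows "\<exists>i\<in>I. x i \<in> E"
  using assms(2-4)
proof (induction I)
  case empty
  then show ?case
    using prime_semigroup_ideal_zero_notin[OF assms(1)] by simp
next
  case (insert j I)
  have "sum x I \<in> S"
    using insert.prems(1) by (intro sum_mem) auto
  then show ?case
    using insert assms(1) by (auto simp: prime_semigroup_ideal_def)
qed

lemma semigroup_symbolic_power_antimono:
  assumes "semigroup_ideal S E" "m \<le> n"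
  shows "semigroup_symbolic_power S E n \<subseteq> semigroup_symbolic_power S E m"
  using semigroup_power_antimono[OF assms] by (auto simp: semigroup_symbolic_power_def)

end

text \<open>Finitely supported functions are used so that the exponents of the product again live in
  a commutative monoid to which \<open>unique_sums_poly_mapping\<close> applies.\<close>

definition product_semigroup :: "'i set \<Rightarrow> ('i \<Rightarrow> 'v::zero set) \<Rightarrow> ('i \<Rightarrow>\<^sub>0 'v) set"
  where "product_semigroup I S = {t. keys t \<subseteq> I \<and> (\<forall>i\<in>I. lookup t i \<in> S i)}"

text \<open>The contraction of \<open>E\<close> along the inclusion \<open>single i\<close> of the
  \<open>i\<close>-th factor.\<close>

definition component_ideal :: "('i \<Rightarrow> 'v::zero set) \<Rightarrow> ('i \<Rightarrow>\<^sub>0 'v) set \<Rightarrow> 'i \<Rightarrow> 'v set"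
  where "component_ideal S E i = {m \<in> S i. single i m \<in> E}"

locale submonoid_family =
  fixes I :: "'i set" and S :: "'i \<Rightarrow> 'v::comm_monoid_add set"
  assumes finite_index: "finite I"
    and submonoid: "i \<in> I \<Longrightarrow> additive_submonoid (S i)"
begin

abbreviation "T \<equiv> product_semigroup I S"

lemma zero_component: "i \<in> I \<Longrightarrow> 0 \<in> S i"
  using submonoid by (simp add: additive_submonoid_def)

lemma additive_submonoid_product: "additive_submonoid T"
proof
  show "0 \<in> T"
    by (simp add: product_semigroup_def zero_component)
  show "a + b \<in> T" if "a \<in> T" "b \<in> T" for a b
    using that Poly_Mapping.keys_add[of a b] additive_submonoid.add_mem[OF submonoid]
    by (auto simp: product_semigroup_def lookup_add)
qed

sublocale product: additive_submonoid T
  by (rule additive_submonoid_product)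

lemma single_mem_product: "i \<in> I \<Longrightarrow> m \<in> S i \<Longrightarrow> single i m \<in> T"
  by (auto simp: product_semigroup_def lookup_single when_def zero_component)

lemma product_eq_sum_single: "t \<in> T \<Longrightarrow> t = (\<Sum>i\<in>I. single i (lookup t i))"
  by (rule poly_mapping_eqI)
    (auto simp: product_semigroup_def lookup_sum lookup_single when_def finite_index
      in_keys_iff sum.delta' cong: if_cong)

text \<open>Contraction along an additive map preserves the ideal and primality conditions, and 0
  stays outside.\<close>

lemma prime_component_ideal:
  assumes "prime_semigroup_ideal T E" "i \<in> I"
  shows "prime_semigroup_ideal (S i) (component_ideal S E i)"
proof -
  interpret Si: additive_submonoid "S i"
    by (rule submonoid[OF assms(2)])
  have "semigroup_ideal T E" "\<And>a b. a \<in> T \<Longrightarrow> b \<in> T \<Longrightarrow> a + b \<in> E \<Longrightarrow> a \<in> E \<or> b \<in> E"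
    using assms(1) by (auto simp: prime_semigroup_ideal_def)
  moreover have "component_ideal S E i \<noteq> S i"
    using product.prime_semigroup_ideal_zero_notin[OF assms(1)] Si.zero_mem
    by (metis (lifting) component_ideal_def mem_Collect_eq single_zero)
  ultimately show ?thesis
    using single_mem_product[OF assms(2)] Si.add_mem
    unfolding prime_semigroup_ideal_def semigroup_ideal_def component_ideal_def
    by (auto simp: single_add)
qed

lemma single_mem_semigroup_power:
  assumes "i \<in> I" "m \<in> semigroup_power (S i) (component_ideal S E i) r"
  shows "single i m \<in> semigroup_power T E r"
  using assms(2)
proof (induction r arbitrary: m)
  case 0
  then show ?case
    using assms(1) by (simp add: single_mem_product)
next
  case (Suc r)
  then obtain a b where "a \<in> semigroup_power (S i) (component_ideal S E i) r"
    "b \<in> component_ideal S E i" "m = a + b"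
    by auto
  then show ?case
    using Suc.IH[of a] by (auto simp: single_add component_ideal_def)
qed

text \<open>Each of the \<open>N\<close> summands from \<open>E\<close> is the sum of its own
  components, so by primality some component lies in the ideal of its factor. The summand is
  credited to one such factor \<open>j\<close>; in the other factors it is merely absorbed.\<close>

lemma semigroup_power_components:
  assumes "prime_semigroup_ideal T E" "t \<in> semigroup_power T E N"
  obtains a where "sum a I = N"
    "\<And>i. i \<in> I \<Longrightarrow> lookup t i \<in> semigroup_power (S i) (component_ideal S E i) (a i)"
proof -
  have "\<exists>a. sum a I = N \<and> (\<forall>i\<in>I. lookup t i \<in> semigroup_power (S i) (component_ideal S E i) (a i))"
    using assms(2)
  proof (induction N arbitrary: t)
    case 0
    then show ?case
      by (intro exI[of _ "\<lambda>_. 0"]) (simp add: product_semigroup_def)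
  next
    case (Suc N)
    then obtain u e where ue: "u \<in> semigroup_power T E N" "e \<in> E" "t = u + e"
      by auto
    then obtain a where a: "sum a I = N"
      "\<forall>i\<in>I. lookup u i \<in> semigroup_power (S i) (component_ideal S E i) (a i)"
      using Suc.IH by blast
    have "e \<in> T"
      using ue(2) assms(1) by (auto simp: prime_semigroup_ideal_def semigroup_ideal_def)
    then have eS: "lookup e i \<in> S i" if "i \<in> I" for i
      using that by (simp add: product_semigroup_def)
    have "(\<Sum>i\<in>I. single i (lookup e i)) \<in> E"
      using product_eq_sum_single[OF \<open>e \<in> T\<close>] ue(2) by simp
    then obtain j where j: "j \<in> I" "single j (lookup e j) \<in> E"
      using product.prime_semigroup_ideal_sum[OF assms(1) finite_index, of "\<lambda>i. single i (lookup e i)"]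
        eS single_mem_product by blast
    show ?case
    proof (intro exI[of _ "a(j := Suc (a j))"] conjI ballI)
      show "sum (a(j := Suc (a j))) I = Suc N"
        using j(1) a(1) finite_index by (simp add: sum.remove[of I j])
      fix i
      assume i: "i \<in> I"
      have "semigroup_ideal (S i) (component_ideal S E i)"
        using prime_component_ideal[OF assms(1) i] by (simp add: prime_semigroup_ideal_def)
      from additive_submonoid.semigroup_ideal_power[OF submonoid[OF i] this]
      have "lookup u i + lookup e i \<in> semigroup_power (S i) (component_ideal S E i) (a i)"
        using a(2) i eS by (auto simp: semigroup_ideal_def)
      moreover have "lookup u j + lookup e j \<in> semigroup_power (S j) (component_ideal S E j) (Suc (a j))"
        using a(2) j eS by (auto simp: component_ideal_def)
      ultimately show "lookup t i \<in> semigroup_power (S i) (component_ideal S E i) ((a(j := Suc (a j))) i)"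
        by (simp add: ue(3) lookup_add)
    qed
  qed
  then show ?thesis
    using that by blast
qed

text \<open>Rounding up each quotient \<open>a i / d\<close> cannot decrease the sum, and
  \<open>D i \<le> d\<close> makes the bound of every factor applicable to the rounded
  orders.\<close>

lemma product_symbolic_power_bound:
  fixes D :: "'i \<Rightarrow> nat"
  assumes E: "prime_semigroup_ideal T E" and "I \<noteq> {}" and D: "\<And>i. i \<in> I \<Longrightarrow> D i > 0"
    and bound: "\<And>i r. i \<in> I \<Longrightarrow> r > 0 \<Longrightarrow>
      semigroup_symbolic_power (S i) (component_ideal S E i) (D i * (r - 1) + 1)
        \<subseteq> semigroup_power (S i) (component_ideal S E i) r"
    and "r > 0"
  shows "semigroup_symbolic_power T E (Max (D ` I) * (r - 1) + 1) \<subseteq> semigroup_power T E r"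
proof
  fix t
  assume t: "t \<in> semigroup_symbolic_power T E (Max (D ` I) * (r - 1) + 1)"
  define d where "d = Max (D ` I)"
  have D_le: "D i \<le> d" if "i \<in> I" for i
    using that finite_index by (simp add: d_def)
  with D \<open>I \<noteq> {}\<close> have "d > 0"
    by (metis all_not_in_conv gr0I le_zero_eq)
  have "t \<in> T"
    using t by (simp add: semigroup_symbolic_power_def)
  from t obtain u where u: "u \<in> T - E" "u + t \<in> semigroup_power T E (d * (r - 1) + 1)"
    by (auto simp: semigroup_symbolic_power_def d_def)
  obtain a where a: "sum a I = d * (r - 1) + 1"
    "\<And>i. i \<in> I \<Longrightarrow> lookup (u + t) i \<in> semigroup_power (S i) (component_ideal S E i) (a i)"
    using semigroup_power_components[OF E u(2)] by blast
  \<comment> \<open>This is the ceiling of \<open>a i / d\<close>. The case \<open>a i = 0\<close>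
    is separate because subtraction of natural numbers would give 1 there.\<close>
  define \<rho> where "\<rho> i = (if a i = 0 then 0 else (a i - 1) div d + 1)" for i
  have mem: "lookup t i \<in> semigroup_power (S i) (component_ideal S E i) (\<rho> i)" if i: "i \<in> I" for i
  proof (cases "a i = 0")
    case True
    then show ?thesis
      using \<open>t \<in> T\<close> i by (simp add: \<rho>_def product_semigroup_def)
  next
    case False
    \<comment> \<open>The component of \<open>u\<close> stays in the face of its factor: otherwise
      adding the other components would put \<open>u\<close> into \<open>E\<close>.\<close>
    have "single i (lookup u i) \<notin> E"
    proof
      assume "single i (lookup u i) \<in> E"
      moreover have "(\<Sum>j\<in>I - {i}. single j (lookup u j)) \<in> T"
        using u(1) by (intro product.sum_mem single_mem_product) (auto simp: product_semigroup_def)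
      ultimately have "single i (lookup u i) + (\<Sum>j\<in>I - {i}. single j (lookup u j)) \<in> E"
        using E by (simp add: prime_semigroup_ideal_def semigroup_ideal_def)
      also have "single i (lookup u i) + (\<Sum>j\<in>I - {i}. single j (lookup u j)) = (\<Sum>j\<in>I. single j (lookup u j))"
        by (rule sum.remove[OF finite_index i, symmetric])
      also have "\<dots> = u"
        using u(1) by (intro product_eq_sum_single[symmetric]) simp
      finally show False
        using u(1) by simp
    qed
    then have "lookup t i \<in> semigroup_symbolic_power (S i) (component_ideal S E i) (a i)"
      using a(2)[OF i] i u(1) \<open>t \<in> T\<close>
      by (auto simp: semigroup_symbolic_power_def lookup_add component_ideal_def product_semigroup_def)
    \<comment> \<open>The order which the bound requires for \<open>\<rho> i\<close> is at most
      \<open>a i\<close>, and symbolic powers decrease as the order grows.\<close>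
    moreover have "D i * (\<rho> i - 1) + 1 \<le> a i"
    proof -
      have "D i * ((a i - 1) div d) \<le> d * ((a i - 1) div d)"
        using D_le[OF i] by (rule mult_le_mono1)
      also have "\<dots> \<le> a i - 1"
        by simp
      finally show ?thesis
        using False by (simp add: \<rho>_def)
    qed
    moreover have "semigroup_ideal (S i) (component_ideal S E i)"
      using prime_component_ideal[OF E i] by (simp add: prime_semigroup_ideal_def)
    ultimately have "lookup t i \<in> semigroup_symbolic_power (S i) (component_ideal S E i) (D i * (\<rho> i - 1) + 1)"
      using additive_submonoid.semigroup_symbolic_power_antimono[OF submonoid[OF i]] by blast
    then show ?thesis
      using bound[OF i, of "\<rho> i"] False by (auto simp: \<rho>_def)
  qed
  have E_ideal: "semigroup_ideal T E"
    using E by (simp add: prime_semigroup_ideal_def)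
  have "(\<Sum>i\<in>I. single i (lookup t i)) \<in> semigroup_power T E (sum \<rho> I)"
    using mem single_mem_semigroup_power
    by (intro product.semigroup_power_sum[OF E_ideal finite_index]) blast
  then have "t \<in> semigroup_power T E (sum \<rho> I)"
    using product_eq_sum_single[OF \<open>t \<in> T\<close>] by simp
  moreover have "r \<le> sum \<rho> I"
  proof -
    have "a i \<le> d * \<rho> i" for i
    proof (cases "a i = 0")
      case False
      have "a i - 1 < d * ((a i - 1) div d) + d"
        using \<open>d > 0\<close> by (metis add.commute add_less_cancel_right mod_less_divisor mult_div_mod_eq)
      then show ?thesis
        using False by (simp add: \<rho>_def)
    qed simp
    then have "sum a I \<le> d * sum \<rho> I"
      by (simp add: sum_distrib_left sum_mono)
    \<comment> \<open>The extra 1 in \<open>sum a I\<close> makes the inequality strict, which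
      yields the power \<open>r\<close> and not only \<open>r - 1\<close>.\<close>
    then have "d * (r - 1) < d * sum \<rho> I"
      using a(1) by linarith
    then have "r - 1 < sum \<rho> I"
      by simp
    then show ?thesis
      by linarith
  qed
  ultimately show "t \<in> semigroup_power T E r"
    using product.semigroup_power_antimono[OF E_ideal] by blast
qed

end

section \<open>Transport along ring isomorphisms\<close>

lemma (in cring) ideal_ideal_power: "ideal P R \<Longrightarrow> ideal (ideal_power R P r) R"
  by (induction r) (auto simp: ideal_power_0 ideal_power_Suc oneideal intro: ideal_prod_is_ideal)

locale ring_isomorphism = A: cring A + B: cring B for A (structure) and B (structure) +
  fixes h
  assumes iso: "h \<in> ring_iso A B"
begin

lemma hom: "h \<in> ring_hom A B" and bij: "bij_betw h (carrier A) (carrier B)"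
  using iso by (auto simp: ring_iso_def)

lemma image_carrier: "h ` carrier A = carrier B"
  using bij by (simp add: bij_betw_def)

lemma inj: "inj_on h (carrier A)"
  using bij by (simp add: bij_betw_def)

lemma hom_ring: "ring_hom_ring A B h"
  by (intro ring_hom_ringI2 A.ring_axioms B.ring_axioms hom)

lemma mem_image_iff:
  assumes "P \<subseteq> carrier A" "a \<in> carrier A"
  shows "h a \<in> h ` P \<longleftrightarrow> a \<in> P"
  using assms inj by (auto dest: inj_onD)

text \<open>The image under an isomorphism is the preimage under its inverse, and preimages of
  ideals under ring homomorphisms are ideals.\<close>

lemma ideal_image:
  assumes "ideal P A"
  shows "ideal (h ` P) B"
proof -
  interpret P: ideal P A
    by (rule assms)
  let ?g = "inv_into (carrier A) h"
  have "?g \<in> ring_iso B A"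
    by (rule ring_iso_set_sym[OF A.ring_axioms iso])
  then have "ring_hom_ring B A ?g"
    by (intro ring_hom_ringI2 A.ring_axioms B.ring_axioms) (simp add: ring_iso_def)
  then have "ideal {b \<in> carrier B. ?g b \<in> P} B"
    by (rule ring_hom_ring.ideal_vimage[OF _ assms])
  also have "{b \<in> carrier B. ?g b \<in> P} = h ` P"
  proof (intro subset_antisym subsetI)
    fix b
    assume "b \<in> {b \<in> carrier B. ?g b \<in> P}"
    then show "b \<in> h ` P"
      using f_inv_into_f[of b h "carrier A"] image_carrier by (auto intro!: image_eqI[of _ h "?g b"])
  next
    fix b
    assume "b \<in> h ` P"
    then show "b \<in> {b \<in> carrier B. ?g b \<in> P}"
      using P.a_subset image_carrier inv_into_f_f[OF inj] by auto
  qed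
  finally show ?thesis .
qed

lemma primeideal_image:
  assumes "primeideal P A"
  shows "primeideal (h ` P) B"
proof -
  interpret P: primeideal P A
    by (rule assms)
  show ?thesis
  proof (rule primeidealI[OF ideal_image[OF P.is_ideal] B.is_cring])
    show "carrier B \<noteq> h ` P"
      using P.I_notcarr P.a_subset inj_on_image_eq_iff[OF inj, of "carrier A" P] image_carrier by auto
    fix x y
    assume xy: "x \<in> carrier B" "y \<in> carrier B" "x \<otimes>\<^bsub>B\<^esub> y \<in> h ` P"
    then obtain a b where ab: "a \<in> carrier A" "b \<in> carrier A" "x = h a" "y = h b"
      using image_carrier by blast
    then have "a \<otimes> b \<in> P"
      using xy(3) mem_image_iff[OF P.a_subset, of "a \<otimes> b"] ring_hom_mult[OF hom] by simp
    then show "x \<in> h ` P \<or> y \<in> h ` P"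
      using P.I_prime ab by auto
  qed
qed

text \<open>Each inclusion is the minimality of a generated ideal, applied to a preimage in
  \<open>A\<close> and to an image in \<open>B\<close>.\<close>

lemma genideal_image:
  assumes "C \<subseteq> carrier A"
  shows "h ` genideal A C = genideal B (h ` C)"
proof
  have hC: "h ` C \<subseteq> carrier B"
    using assms image_carrier by blast
  have "ideal {a \<in> carrier A. h a \<in> genideal B (h ` C)} A"
    by (rule ring_hom_ring.ideal_vimage[OF hom_ring B.genideal_ideal[OF hC]])
  moreover have "C \<subseteq> {a \<in> carrier A. h a \<in> genideal B (h ` C)}"
    using assms B.genideal_self[OF hC] by auto
  ultimately have "genideal A C \<subseteq> {a \<in> carrier A. h a \<in> genideal B (h ` C)}"
    by (rule A.genideal_minimal)
  then show "h ` genideal A C \<subseteq> genideal B (h ` C)"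
    by blast
  show "genideal B (h ` C) \<subseteq> h ` genideal A C"
    using A.genideal_self[OF assms]
    by (intro B.genideal_minimal ideal_image A.genideal_ideal assms image_mono)
qed

lemma monomial_prime_image:
  assumes "Mon \<subseteq> carrier A" "monomial_prime A Mon P"
  shows "monomial_prime B (h ` Mon) (h ` P)"
proof -
  obtain C where "primeideal P A" "C \<subseteq> Mon" "P = genideal A C"
    using assms(2) by (auto simp: monomial_prime_def)
  then have "primeideal (h ` P) B" "h ` C \<subseteq> h ` Mon" "h ` P = genideal B (h ` C)"
    using assms(1) primeideal_image genideal_image[of C] by (blast, blast, simp)
  then show ?thesis
    unfolding monomial_prime_def by blast
qed

lemma ideal_prod_image:
  assumes "ideal P A" "ideal Q A"
  shows "h ` ideal_prod A P Q = ideal_prod B (h ` P) (h ` Q)"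
proof -
  have carr: "ideal_prod A P Q \<subseteq> carrier A" "P \<subseteq> carrier A" "Q \<subseteq> carrier A"
    using A.ideal_prod_in_carrier[OF assms] assms by (auto simp: ideal.Icarr)
  have "h x \<in> ideal_prod B (h ` P) (h ` Q)" if "x \<in> ideal_prod A P Q" for x
    using that
  proof (induction x rule: ideal_prod.induct)
    case (prod i j)
    then show ?case
      using carr ring_hom_mult[OF hom, of i j] ideal_prod.prod[of "h i" "h ` P" "h j" "h ` Q" B]
      by (simp add: subset_iff)
  next
    case (sum x y)
    then have "h (x \<oplus> y) = h x \<oplus>\<^bsub>B\<^esub> h y"
      using carr by (intro ring_hom_add[OF hom]) auto
    then show ?case
      using sum.IH by (simp add: ideal_prod.sum)
  qed
  moreover have "y \<in> h ` ideal_prod A P Q" if "y \<in> ideal_prod B (h ` P) (h ` Q)" for y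
    using that
  proof (induction y rule: ideal_prod.induct)
    case (prod i j)
    then obtain a b where ab: "a \<in> P" "b \<in> Q" "i = h a" "j = h b"
      by auto
    then have "h (a \<otimes> b) = i \<otimes>\<^bsub>B\<^esub> j"
      using carr ring_hom_mult[OF hom, of a b] by auto
    then show ?case
      using ideal_prod.prod[of a P b Q A] ab by (metis image_eqI)
  next
    case (sum x y)
    then obtain a b where ab: "a \<in> ideal_prod A P Q" "b \<in> ideal_prod A P Q" "x = h a" "y = h b"
      by auto
    then have "h (a \<oplus> b) = x \<oplus>\<^bsub>B\<^esub> y"
      using carr ring_hom_add[OF hom, of a b] by auto
    then show ?case
      using ideal_prod.sum[OF ab(1,2)] by (metis image_eqI)
  qed
  ultimately show ?thesis
    by blast
qed

lemma ideal_power_image: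
  assumes "ideal P A"
  shows "h ` ideal_power A P r = ideal_power B (h ` P) r"
  by (induction r)
    (simp_all add: ideal_power_0 ideal_power_Suc image_carrier ideal_prod_image A.ideal_ideal_power assms)

text \<open>By injectivity a multiplier outside \<open>P\<close> maps outside the image of
  \<open>P\<close>, and \<open>f\<close> lies in a power of \<open>P\<close> as soon as
  \<open>h f\<close> lies in the image of that power.\<close>

lemma symbolic_power_subset_transfer:
  assumes P: "primeideal P A"
    and sub: "symbolic_power B (h ` P) a \<subseteq> ideal_power B (h ` P) r"
  shows "symbolic_power A P a \<subseteq> ideal_power A P r"
proof
  interpret P: primeideal P A
    by (rule P)
  have carr: "ideal_power A P k \<subseteq> carrier A" for k
    by (intro subsetI, rule ideal.Icarr[OF A.ideal_ideal_power[OF P.is_ideal]])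
  fix f
  assume "f \<in> symbolic_power A P a"
  then obtain s where s: "f \<in> carrier A" "s \<in> carrier A" "s \<notin> P" "s \<otimes> f \<in> ideal_power A P a"
    by (auto simp: A.symbolic_power_primeideal[OF P])
  then have "h s \<otimes>\<^bsub>B\<^esub> h f \<in> ideal_power B (h ` P) a"
    by (simp add: ring_hom_mult[OF hom, symmetric] flip: ideal_power_image[OF P.is_ideal])
  moreover have "h s \<in> carrier B - h ` P" "h f \<in> carrier B"
    using s mem_image_iff[OF P.a_subset s(2)] image_carrier by auto
  ultimately have "h f \<in> symbolic_power B (h ` P) a"
    by (auto simp: B.symbolic_power_primeideal[OF primeideal_image[OF P]])
  then have "h f \<in> h ` ideal_power A P r"
    using sub by (auto simp: ideal_power_image[OF P.is_ideal])
  then show "f \<in> ideal_power A P r"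
    using mem_image_iff[OF carr s(1)] by simp
qed

end

section \<open>The tensor product as a semigroup algebra\<close>

text \<open>The algebra map induced by the inclusion \<open>single i\<close> of exponents.\<close>

definition embed_component :: "'i \<Rightarrow> ('v::comm_monoid_add \<Rightarrow>\<^sub>0 'f::field) \<Rightarrow> ('i \<Rightarrow>\<^sub>0 'v) \<Rightarrow>\<^sub>0 'f"
  where "embed_component i = additive_sum (\<lambda>m. single (single i m))"

text \<open>The linear extension of the multilinear map that multiplies the embedded entries of a
  tuple. Its kernel will turn out to be the ideal of tensor relations.\<close>

definition tensor_eval ::
    "'i set \<Rightarrow> (('i \<Rightarrow> 'v::comm_monoid_add \<Rightarrow>\<^sub>0 'f::field) \<Rightarrow>\<^sub>0 'f) \<Rightarrow> ('i \<Rightarrow>\<^sub>0 'v) \<Rightarrow>\<^sub>0 'f"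
  where "tensor_eval I = additive_sum (\<lambda>x c. single 0 c * (\<Prod>i\<in>I. embed_component i (x i)))"

definition monomial_tuple :: "'i set \<Rightarrow> ('i \<Rightarrow>\<^sub>0 'v::zero) \<Rightarrow> 'i \<Rightarrow> 'v \<Rightarrow>\<^sub>0 'f::field"
  where "monomial_tuple I t = (\<lambda>i\<in>I. single (lookup t i) 1)"

text \<open>A linear right inverse of the evaluation, choosing a tuple of monomials for each
  exponent.\<close>

definition tensor_section ::
    "'i set \<Rightarrow> (('i \<Rightarrow>\<^sub>0 'v::zero) \<Rightarrow>\<^sub>0 'f::field) \<Rightarrow> ('i \<Rightarrow> 'v \<Rightarrow>\<^sub>0 'f) \<Rightarrow>\<^sub>0 'f"
  where "tensor_section I = additive_sum (\<lambda>t. single (monomial_tuple I t))"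

text \<open>The product of \<open>tuple_algebra\<close> in a form whose biadditivity is immediate,
  so that identities can be checked on single tuples.\<close>

definition tuple_mult ::
    "'i set \<Rightarrow> (('i \<Rightarrow> 'v::comm_monoid_add \<Rightarrow>\<^sub>0 'f::field) \<Rightarrow>\<^sub>0 'f) \<Rightarrow> (('i \<Rightarrow> 'v \<Rightarrow>\<^sub>0 'f) \<Rightarrow>\<^sub>0 'f)
      \<Rightarrow> (('i \<Rightarrow> 'v \<Rightarrow>\<^sub>0 'f) \<Rightarrow>\<^sub>0 'f)"
  where "tuple_mult I f g =
    additive_sum (\<lambda>x a. additive_sum (\<lambda>y b. single (\<lambda>i\<in>I. x i * y i) (a * b)) g) f"

lemma embed_component_single [simp]: "embed_component i (single m c) = single (single i m) c"
  by (simp add: embed_component_def additive_sum_single)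

lemma embed_component_zero [simp]: "embed_component i 0 = 0"
  by (simp add: embed_component_def)

lemma embed_component_add: "embed_component i (f + g) = embed_component i f + embed_component i g"
  unfolding embed_component_def by (rule additive_sum_add) (simp_all add: single_add)

lemma embed_component_one [simp]: "embed_component i 1 = 1"
  by (simp flip: single_one)

text \<open>Both sides are biadditive in \<open>f\<close> and \<open>g\<close>, so single terms
  suffice.\<close>

lemma embed_component_times: "embed_component i (f * g) = embed_component i f * embed_component i g"
proof (induction f rule: poly_mapping_additive_induct[where A = UNIV, OF subset_UNIV])
  case (2 m c)
  show ?case
  proof (induction g rule: poly_mapping_additive_induct[where A = UNIV, OF subset_UNIV])
    case (3 g h)
    then show ?case
      by (simp add: distrib_left embed_component_add)
  qed (simp_all add: mult_single single_add)
next
  case (3 f g)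
  then show ?case
    by (simp add: distrib_right embed_component_add)
qed simp

lemma tensor_eval_zero [simp]: "tensor_eval I 0 = 0"
  by (simp add: tensor_eval_def)

lemma tensor_eval_add: "tensor_eval I (f + g) = tensor_eval I f + tensor_eval I g"
  unfolding tensor_eval_def by (rule additive_sum_add) (simp_all add: single_add distrib_right)

lemma tensor_eval_single: "tensor_eval I (single x c) = single 0 c * (\<Prod>i\<in>I. embed_component i (x i))"
  by (simp add: tensor_eval_def additive_sum_single)

lemma tensor_eval_diff: "tensor_eval I (f - g) = tensor_eval I f - tensor_eval I g"
  using tensor_eval_add[of I "f - g" g] by (simp add: algebra_simps)

lemma tensor_section_zero [simp]: "tensor_section I 0 = 0"
  by (simp add: tensor_section_def)

lemma tensor_section_add: "tensor_section I (f + g) = tensor_section I f + tensor_section I g"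
  unfolding tensor_section_def by (rule additive_sum_add) (simp_all add: single_add)

lemma tensor_section_single: "tensor_section I (single t c) = single (monomial_tuple I t) c"
  by (simp add: tensor_section_def additive_sum_single)

lemma tuple_mult_zero_left [simp]: "tuple_mult I 0 g = 0"
  by (simp add: tuple_mult_def)

lemma tuple_mult_zero_right [simp]: "tuple_mult I f 0 = 0"
  by (simp add: tuple_mult_def additive_sum_def)

lemma tuple_mult_add_right: "tuple_mult I f (g + h) = tuple_mult I f g + tuple_mult I f h"
proof -
  have "additive_sum (\<lambda>y b. single (\<lambda>i\<in>I. x i * y i) (a * b)) (g + h) =
      additive_sum (\<lambda>y b. single (\<lambda>i\<in>I. x i * y i) (a * b)) g +
      additive_sum (\<lambda>y b. single (\<lambda>i\<in>I. x i * y i) (a * b)) h" for x a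
    by (rule additive_sum_add) (simp_all add: single_add distrib_left)
  then show ?thesis
    by (simp add: tuple_mult_def additive_sum_def[of _ f] sum.distrib)
qed

lemma tuple_mult_add_left: "tuple_mult I (f + g) h = tuple_mult I f h + tuple_mult I g h"
proof -
  have zero: "additive_sum (\<lambda>y b. single (\<lambda>i\<in>I. x i * y i) (0 * b)) h = 0" for x
    by (simp add: additive_sum_def)
  have "additive_sum (\<lambda>y b. single (\<lambda>i\<in>I. x i * y i) ((a + a') * b)) h =
      additive_sum (\<lambda>y b. single (\<lambda>i\<in>I. x i * y i) (a * b)) h +
      additive_sum (\<lambda>y b. single (\<lambda>i\<in>I. x i * y i) (a' * b)) h" for x a a'
    by (simp add: additive_sum_def single_add distrib_right sum.distrib)
  with zero show ?thesis
    unfolding tuple_mult_def by (intro additive_sum_add)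
qed

lemma tuple_mult_single: "tuple_mult I (single x a) (single y b) = single (\<lambda>i\<in>I. x i * y i) (a * b)"
  by (simp add: tuple_mult_def additive_sum_single)

lemma tuple_mult_commute: "tuple_mult I f g = tuple_mult I g f"
proof (induction f rule: poly_mapping_additive_induct[where A = UNIV, OF subset_UNIV])
  case (2 x a)
  show ?case
    by (induction g rule: poly_mapping_additive_induct[where A = UNIV, OF subset_UNIV])
      (simp_all add: tuple_mult_single tuple_mult_add_left tuple_mult_add_right mult.commute)
qed (simp_all add: tuple_mult_add_left tuple_mult_add_right)

lemma tuple_mult_assoc: "tuple_mult I (tuple_mult I f g) h = tuple_mult I f (tuple_mult I g h)"
proof (induction f rule: poly_mapping_additive_induct[where A = UNIV, OF subset_UNIV])
  case (2 x a)
  show ?case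
  proof (induction g rule: poly_mapping_additive_induct[where A = UNIV, OF subset_UNIV])
    case (2 y b)
    show ?case
    proof (induction h rule: poly_mapping_additive_induct[where A = UNIV, OF subset_UNIV])
      case (2 z c)
      have "(\<lambda>i\<in>I. (\<lambda>i\<in>I. x i * y i) i * z i) = (\<lambda>i\<in>I. x i * (\<lambda>i\<in>I. y i * z i) i)"
        by (rule restrict_ext) (simp add: mult.assoc)
      then show ?case
        by (simp only: tuple_mult_single mult.assoc)
    qed (simp_all add: tuple_mult_add_right)
  qed (simp_all add: tuple_mult_add_left tuple_mult_add_right)
qed (simp_all add: tuple_mult_add_left)

lemma single_zero_times:
  "single 0 (a * b) = single 0 a * single (0 :: 'a::comm_monoid_add) (b :: 'b::comm_ring_1)"
  by (simp add: mult_single)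

lemma tensor_eval_mult: "tensor_eval I (tuple_mult I f g) = tensor_eval I f * tensor_eval I g"
proof (induction f rule: poly_mapping_additive_induct[where A = UNIV, OF subset_UNIV])
  case (2 x a)
  show ?case
  proof (induction g rule: poly_mapping_additive_induct[where A = UNIV, OF subset_UNIV])
    case (2 y b)
    show ?case
      by (simp add: tuple_mult_single tensor_eval_single embed_component_times prod.distrib
          single_zero_times mult_ac)
  qed (simp_all add: tuple_mult_add_right tensor_eval_add distrib_left)
qed (simp_all add: tuple_mult_add_left tensor_eval_add distrib_right)

lemma keys_tuple_mult:
  assumes "keys f \<subseteq> A" "keys g \<subseteq> A'" "\<And>x y. x \<in> A \<Longrightarrow> y \<in> A' \<Longrightarrow> (\<lambda>i\<in>I. x i * y i) \<in> A''"
  shows "keys (tuple_mult I f g) \<subseteq> A''"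
  using assms(1)
proof (induction f rule: poly_mapping_additive_induct)
  case (single x a)
  show ?case
    using assms(2)
  proof (induction g rule: poly_mapping_additive_induct)
    case (add g h)
    then show ?case
      using Poly_Mapping.keys_add[of "tuple_mult I (single x a) g" "tuple_mult I (single x a) h"]
      by (auto simp: tuple_mult_add_right)
  qed (use single assms(3) in \<open>auto simp: tuple_mult_single\<close>)
next
  case (add f h)
  then show ?case
    using Poly_Mapping.keys_add[of "tuple_mult I f g" "tuple_mult I h g"]
    by (auto simp: tuple_mult_add_left)
qed simp

lemma monomial_span_prod:
  assumes "additive_submonoid T" "\<And>i. i \<in> I \<Longrightarrow> f i \<in> monomial_span T"
  shows "(\<Prod>i\<in>I. f i) \<in> (monomial_span T :: ('v::comm_monoid_add \<Rightarrow>\<^sub>0 'f::field) set)"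
  using assms(2)
proof (induction I rule: infinite_finite_induct)
  case (insert i I)
  then show ?case
    by (auto intro!: monomial_span_times[where E = T and E' = T]
        intro: additive_submonoid.add_mem[OF assms(1)])
qed (simp_all add: monomial_span_def additive_submonoid.zero_mem[OF assms(1)])

lemma prod_single_one: "(\<Prod>i\<in>I. single (m i) 1) = single (\<Sum>i\<in>I. m i) (1::'f::field)"
  by (induction I rule: infinite_finite_induct) (simp_all add: mult_single)

section \<open>The tuple algebra and its evaluation in the algebra of the product semigroup\<close>

context submonoid_family
begin

abbreviation "tuples \<equiv> (\<Pi>\<^sub>E i\<in>I. monomial_span (S i))"

abbreviation "tuple_ring \<equiv> tuple_algebra I (\<lambda>i. semigroup_algebra (S i))"

lemma tuple_ring_simps [simp]:
  "carrier tuple_ring = {f. keys f \<subseteq> tuples}"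
  "f \<otimes>\<^bsub>tuple_ring\<^esub> g = tuple_mult I f g"
  "f \<oplus>\<^bsub>tuple_ring\<^esub> g = f + g"
  "\<one>\<^bsub>tuple_ring\<^esub> = single (\<lambda>i\<in>I. 1) 1"
  "\<zero>\<^bsub>tuple_ring\<^esub> = 0"
  by (simp_all add: tuple_algebra_def tuple_mult_def additive_sum_def)

lemma one_tuple: "(\<lambda>i\<in>I. 1) \<in> (tuples :: ('i \<Rightarrow> 'v \<Rightarrow>\<^sub>0 'f::field) set)"
  by (auto simp: monomial_span_def zero_component)

lemma tuple_times:
  "x \<in> tuples \<Longrightarrow> y \<in> tuples \<Longrightarrow> (\<lambda>i\<in>I. x i * y i) \<in> (tuples :: ('i \<Rightarrow> 'v \<Rightarrow>\<^sub>0 'f::field) set)"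
  by (auto intro!: monomial_span_times intro: additive_submonoid.add_mem[OF submonoid])

text \<open>The componentwise product with the constant tuple 1 fixes every tuple in
  \<open>tuples\<close>. With \<open>c = 1\<close> this is the unit law; a general \<open>c\<close>
  realizes scalar multiplication inside the ring.\<close>

lemma tuple_mult_one_left:
  assumes "keys f \<subseteq> tuples"
  shows "tuple_mult I (single (\<lambda>i\<in>I. 1) c) f = additive_sum (\<lambda>x a. single x (c * a)) f"
  using assms
proof (induction f rule: poly_mapping_additive_induct)
  case (single x a)
  have "(\<lambda>i\<in>I. (\<lambda>i\<in>I. 1) i * x i) = x"
    using single by (auto simp: PiE_def extensional_def fun_eq_iff)
  then show ?case
    by (simp add: tuple_mult_single additive_sum_single)
next
  case (add f g)
  then show ?case
    by (simp add: tuple_mult_add_right additive_sum_add single_add distrib_left)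
qed simp

lemma cring_tuple_ring: "cring (tuple_ring :: (('i \<Rightarrow> 'v \<Rightarrow>\<^sub>0 'f::field) \<Rightarrow>\<^sub>0 'f) ring)"
proof (rule cringI)
  show "abelian_group (tuple_ring :: (('i \<Rightarrow> 'v \<Rightarrow>\<^sub>0 'f) \<Rightarrow>\<^sub>0 'f) ring)"
  proof (rule abelian_groupI, unfold tuple_ring_simps)
    fix f g :: "('i \<Rightarrow> 'v \<Rightarrow>\<^sub>0 'f) \<Rightarrow>\<^sub>0 'f"
    assume fg: "f \<in> {f. keys f \<subseteq> tuples}" "g \<in> {f. keys f \<subseteq> tuples}"
    then show "f + g \<in> {f. keys f \<subseteq> tuples}"
      using Poly_Mapping.keys_add[of f g] by blast
    show "\<exists>g\<in>{f. keys f \<subseteq> tuples}. g + f = 0"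
      using fg(1) by (intro bexI[of _ "- f"]) auto
  qed (auto simp: add.assoc add.commute)
  show "Group.comm_monoid (tuple_ring :: (('i \<Rightarrow> 'v \<Rightarrow>\<^sub>0 'f) \<Rightarrow>\<^sub>0 'f) ring)"
  proof (rule Group.comm_monoidI, unfold tuple_ring_simps)
    fix f g :: "('i \<Rightarrow> 'v \<Rightarrow>\<^sub>0 'f) \<Rightarrow>\<^sub>0 'f"
    assume fg: "f \<in> {f. keys f \<subseteq> tuples}" "g \<in> {f. keys f \<subseteq> tuples}"
    then show "tuple_mult I f g \<in> {f. keys f \<subseteq> tuples}"
      using keys_tuple_mult[of f tuples g tuples I tuples, OF _ _ tuple_times] by blast
    have "additive_sum single f = f"
      using poly_mapping_sum_single[of f] by (simp add: additive_sum_def)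
    then show "tuple_mult I (single (\<lambda>i\<in>I. 1) 1) f = f"
      using fg(1) by (simp add: tuple_mult_one_left)
    show "tuple_mult I f g = tuple_mult I g f"
      by (rule tuple_mult_commute)
  qed (use one_tuple in \<open>auto simp: tuple_mult_assoc\<close>)
qed (simp add: tuple_mult_add_left)

lemma embed_component_mem: "i \<in> I \<Longrightarrow> f \<in> monomial_span (S i) \<Longrightarrow> embed_component i f \<in> monomial_span T"
  using keys_additive_sum_single[of "single i" f] single_mem_product[of i]
  unfolding monomial_span_def embed_component_def by blast

lemma tensor_eval_mem:
  assumes "keys f \<subseteq> tuples"
  shows "tensor_eval I f \<in> monomial_span T"
  using assms
proof (induction f rule: poly_mapping_additive_induct)
  case (single x c)
  have "single 0 c \<in> monomial_span T"
    by (simp add: monomial_span_single product.zero_mem)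
  moreover have "(\<Prod>i\<in>I. embed_component i (x i)) \<in> monomial_span T"
    using single by (intro monomial_span_prod additive_submonoid_product embed_component_mem) auto
  ultimately show ?case
    unfolding tensor_eval_single by (rule monomial_span_times) (rule product.add_mem)
qed (simp_all add: tensor_eval_add monomial_span_add)

lemma tensor_eval_hom:
  "ring_hom_ring (tuple_ring :: (('i \<Rightarrow> 'v \<Rightarrow>\<^sub>0 'f::field) \<Rightarrow>\<^sub>0 'f) ring)
    (semigroup_algebra T) (tensor_eval I)"
  by (intro ring_hom_ringI2 ring_hom_memI cring.axioms(1) cring_tuple_ring product.cring_semigroup_algebra)
    (simp_all add: tensor_eval_mem tensor_eval_mult tensor_eval_add tensor_eval_single)

lemma monomial_tuple_mem: "t \<in> T \<Longrightarrow> monomial_tuple I t \<in> tuples"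
  by (auto simp: monomial_tuple_def product_semigroup_def monomial_span_def)

text \<open>Lets the tensor monomials be indexed by the exponents in \<open>T\<close>.\<close>

lemma monomial_tuples:
  "(\<Pi>\<^sub>E i\<in>I. monomials (S i)) = (monomial_tuple I ` T :: ('i \<Rightarrow> 'v \<Rightarrow>\<^sub>0 'f::field) set)"
proof (intro subset_antisym subsetI)
  fix x :: "'i \<Rightarrow> 'v \<Rightarrow>\<^sub>0 'f"
  assume x: "x \<in> (\<Pi>\<^sub>E i\<in>I. monomials (S i))"
  then have "\<forall>i\<in>I. \<exists>m. m \<in> S i \<and> x i = single m 1"
    by (auto simp: monomials_def)
  then obtain m where m: "\<forall>i\<in>I. m i \<in> S i \<and> x i = single (m i) 1"
    by metis
  define t where "t = (\<Sum>i\<in>I. single i (m i))"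
  have "t \<in> T"
    unfolding t_def using m by (intro product.sum_mem single_mem_product) auto
  moreover have "lookup t i = m i" if "i \<in> I" for i
    using that finite_index by (simp add: t_def lookup_sum lookup_single when_def sum.delta')
  then have "x = monomial_tuple I t"
    using x m by (auto simp: monomial_tuple_def fun_eq_iff PiE_def extensional_def)
  ultimately show "x \<in> monomial_tuple I ` T"
    by blast
qed (auto simp: monomial_tuple_def monomials_def product_semigroup_def)

lemma tensor_eval_monomial_tuple:
  fixes c :: "'f::field"
  assumes "t \<in> T"
  shows "tensor_eval I (single (monomial_tuple I t) c) = single t c"
proof -
  have "(\<Prod>i\<in>I. embed_component i (monomial_tuple I t i :: 'v \<Rightarrow>\<^sub>0 'f)) = (\<Prod>i\<in>I. single (single i (lookup t i)) 1)"
    by (rule prod.cong) (simp_all add: monomial_tuple_def)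
  also have "\<dots> = single t 1"
    using product_eq_sum_single[OF assms] by (simp add: prod_single_one)
  finally show ?thesis
    by (simp add: tensor_eval_single mult_single)
qed

lemma tensor_section_mem: "f \<in> monomial_span T \<Longrightarrow> keys (tensor_section I f) \<subseteq> tuples"
  using keys_additive_sum_single[of "monomial_tuple I" f] monomial_tuple_mem
  unfolding monomial_span_def tensor_section_def by blast

lemma tensor_eval_section:
  assumes "f \<in> monomial_span T"
  shows "tensor_eval I (tensor_section I f) = f"
proof -
  have "keys f \<subseteq> T"
    using assms by (simp add: monomial_span_def)
  then show ?thesis
    by (induction f rule: poly_mapping_additive_induct)
      (simp_all add: tensor_section_single tensor_eval_monomial_tuple tensor_section_add tensor_eval_add)
qed

lemma tensor_eval_surj:
  "tensor_eval I ` carrier tuple_ring = carrier (semigroup_algebra T :: ('f::field, ('i \<Rightarrow>\<^sub>0 'v) \<Rightarrow>\<^sub>0 'f) module)"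
proof (intro subset_antisym subsetI)
  fix f :: "('i \<Rightarrow>\<^sub>0 'v) \<Rightarrow>\<^sub>0 'f"
  assume "f \<in> carrier (semigroup_algebra T)"
  then show "f \<in> tensor_eval I ` carrier tuple_ring"
    using tensor_eval_section[of f] tensor_section_mem[of f] by (auto intro!: image_eqI[of f _ "tensor_section I f"])
qed (auto simp: tensor_eval_mem)

section \<open>The multilinear relations and the kernel of the evaluation\<close>

abbreviation "relations \<equiv> multilinear_relations I (\<lambda>i. semigroup_algebra (S i))"

abbreviation "relation_ideal \<equiv> tensor_ideal I (\<lambda>i. semigroup_algebra (S i))"

text \<open>Isolates the \<open>j\<close>-th entry as one factor, so that linearity of the
  evaluation in that entry can be read off.\<close>

lemma tensor_eval_update:
  assumes "j \<in> I"
  shows "tensor_eval I (single (x(j := u)) c) = single 0 c * embed_component j u * (\<Prod>i\<in>I - {j}. embed_component i (x i))"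
proof -
  have "(\<Prod>i\<in>I - {j}. embed_component i ((x(j := u)) i)) = (\<Prod>i\<in>I - {j}. embed_component i (x i))"
    by (rule prod.cong) simp_all
  then show ?thesis
    using assms by (simp add: tensor_eval_single prod.remove[OF finite_index assms] mult.assoc)
qed

lemma update_mem_tuples:
  "x \<in> tuples \<Longrightarrow> j \<in> I \<Longrightarrow> u \<in> monomial_span (S j) \<Longrightarrow> x(j := u) \<in> tuples"
  by (auto simp: PiE_def extensional_def)

lemma mem_kernel_tensor_eval:
  "f \<in> a_kernel tuple_ring (semigroup_algebra T) (tensor_eval I) \<longleftrightarrow>
    keys f \<subseteq> tuples \<and> tensor_eval I f = 0"
  by (simp add: a_kernel_def kernel_def)

lemma relations_kernel:
  "relations \<subseteq> a_kernel tuple_ring (semigroup_algebra T :: ('f::field, ('i \<Rightarrow>\<^sub>0 'v) \<Rightarrow>\<^sub>0 'f) module) (tensor_eval I)"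
proof
  fix f :: "('i \<Rightarrow> 'v \<Rightarrow>\<^sub>0 'f) \<Rightarrow>\<^sub>0 'f"
  assume "f \<in> relations"
  then consider
    (add) x j u v where "x \<in> tuples" "j \<in> I" "u \<in> monomial_span (S j)" "v \<in> monomial_span (S j)"
      "f = single (x(j := u + v)) 1 - single (x(j := u)) 1 - single (x(j := v)) 1"
  | (scale) x j c u where "x \<in> tuples" "j \<in> I" "u \<in> monomial_span (S j)"
      "f = single (x(j := single 0 c * u)) 1 - single (x(j := u)) c"
    unfolding multilinear_relations_def by auto
  then have "keys f \<subseteq> tuples \<and> tensor_eval I f = 0"
  proof cases
    case add
    have "x(j := u + v) \<in> tuples" "x(j := u) \<in> tuples" "x(j := v) \<in> tuples"
      using add by (intro update_mem_tuples monomial_span_add; simp)+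
    then have "f \<in> monomial_span tuples"
      unfolding add(5) by (intro monomial_span_diff monomial_span_single)
    moreover have "tensor_eval I f = 0"
      by (simp add: add(5) tensor_eval_diff tensor_eval_add tensor_eval_update[OF add(2)] embed_component_add algebra_simps)
    ultimately show ?thesis
      by (simp add: monomial_span_def)
  next
    case scale
    have "single 0 c * u \<in> monomial_span (S j)"
      by (rule monomial_span_scale[OF scale(3)])
    then have "x(j := single 0 c * u) \<in> tuples" "x(j := u) \<in> tuples"
      using scale by (intro update_mem_tuples; simp)+
    then have "f \<in> monomial_span tuples"
      unfolding scale(4) by (intro monomial_span_diff monomial_span_single)
    moreover have "tensor_eval I f = 0"
      by (simp add: scale(4) tensor_eval_diff tensor_eval_update[OF scale(2)] embed_component_times)
    ultimately show ?thesis
      by (simp add: monomial_span_def)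
  qed
  then show "f \<in> a_kernel tuple_ring (semigroup_algebra T) (tensor_eval I)"
    by (simp add: mem_kernel_tensor_eval)
qed

text \<open>Modulo the relations a tuple expands into monomial tuples, one coordinate after the other; on
  combinations of monomial tuples \<^const>\<open>tensor_section\<close> inverts the evaluation.\<close>

lemma tensor_ideal_eq_kernel:
  "relation_ideal =
    a_kernel tuple_ring (semigroup_algebra T :: ('f::field, ('i \<Rightarrow>\<^sub>0 'v) \<Rightarrow>\<^sub>0 'f) module) (tensor_eval I)"
  (is "_ = ?K")
proof
  interpret A: cring "tuple_ring :: (('i \<Rightarrow> 'v \<Rightarrow>\<^sub>0 'f) \<Rightarrow>\<^sub>0 'f) ring"
    by (rule cring_tuple_ring)
  interpret h: ring_hom_ring "tuple_ring :: (('i \<Rightarrow> 'v \<Rightarrow>\<^sub>0 'f) \<Rightarrow>\<^sub>0 'f) ring"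
      "semigroup_algebra T" "tensor_eval I"
    by (rule tensor_eval_hom)
  show sub: "relation_ideal \<subseteq> ?K"
    unfolding tensor_ideal_def by (rule A.genideal_minimal[OF h.kernel_is_ideal relations_kernel])
  have carrier: "relations \<subseteq> carrier (tuple_ring :: (('i \<Rightarrow> 'v \<Rightarrow>\<^sub>0 'f) \<Rightarrow>\<^sub>0 'f) ring)"
  proof
    fix f :: "('i \<Rightarrow> 'v \<Rightarrow>\<^sub>0 'f) \<Rightarrow>\<^sub>0 'f"
    assume "f \<in> relations"
    then have "f \<in> ?K"
      by (rule subsetD[OF relations_kernel])
    then show "f \<in> carrier tuple_ring"
      by (simp add: mem_kernel_tensor_eval)
  qed
  interpret J: ideal "relation_ideal :: (('i \<Rightarrow> 'v \<Rightarrow>\<^sub>0 'f) \<Rightarrow>\<^sub>0 'f) set"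
      "tuple_ring :: (('i \<Rightarrow> 'v \<Rightarrow>\<^sub>0 'f) \<Rightarrow>\<^sub>0 'f) ring"
    unfolding tensor_ideal_def by (rule A.genideal_ideal[OF carrier])
  have J_add: "f + g \<in> relation_ideal" if "f \<in> relation_ideal" "g \<in> relation_ideal"
    for f g :: "('i \<Rightarrow> 'v \<Rightarrow>\<^sub>0 'f) \<Rightarrow>\<^sub>0 'f"
    using J.a_closed[OF that] by simp
  \<comment> \<open>Multiplying by the constant tuple 1 with coefficient \<open>c\<close> scales a
    relation by \<open>c\<close>, so the ideal contains all scalar multiples of the
    relations.\<close>
  have J_scale: "tuple_mult I (single (\<lambda>i\<in>I. 1) c) f \<in> relation_ideal" if "f \<in> relations"
    for f :: "('i \<Rightarrow> 'v \<Rightarrow>\<^sub>0 'f) \<Rightarrow>\<^sub>0 'f" and c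
  proof -
    have "single (\<lambda>i\<in>I. 1) c \<in> carrier (tuple_ring :: (('i \<Rightarrow> 'v \<Rightarrow>\<^sub>0 'f) \<Rightarrow>\<^sub>0 'f) ring)"
      using monomial_span_single[OF one_tuple, of c] by (simp only: tuple_ring_simps monomial_span_def)
    moreover have "f \<in> relation_ideal"
      using A.genideal_self[OF carrier] that unfolding tensor_ideal_def by blast
    ultimately show ?thesis
      using J.I_l_closed by simp
  qed
  have scale_single: "tuple_mult I (single (\<lambda>i\<in>I. 1) c) (single x a) = single x (c * a)"
    if "x \<in> tuples" for c a and x :: "'i \<Rightarrow> 'v \<Rightarrow>\<^sub>0 'f"
    using that by (simp add: tuple_mult_one_left additive_sum_single)
  have scale_diff: "tuple_mult I h (f - g) = tuple_mult I h f - tuple_mult I h g"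
    for f g h :: "('i \<Rightarrow> 'v \<Rightarrow>\<^sub>0 'f) \<Rightarrow>\<^sub>0 'f"
    using tuple_mult_add_right[of I h "f - g" g] by (simp add: algebra_simps)
  have relation_add: "single (x(j := u + v)) c - single (x(j := u)) c - single (x(j := v)) c \<in> relation_ideal"
    if "x \<in> tuples" "j \<in> I" "u \<in> monomial_span (S j)" "v \<in> monomial_span (S j)"
    for x :: "'i \<Rightarrow> 'v \<Rightarrow>\<^sub>0 'f" and j u v c
  proof -
    have mem: "x(j := u + v) \<in> tuples" "x(j := u) \<in> tuples" "x(j := v) \<in> tuples"
      using that by (intro update_mem_tuples monomial_span_add; simp)+
    have "single (x(j := u + v)) 1 - single (x(j := u)) 1 - single (x(j := v)) 1 \<in> relations"
      unfolding multilinear_relations_def using that by auto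
    from J_scale[OF this, of c] show ?thesis
      by (simp add: scale_diff scale_single mem)
  qed
  have relation_scale: "single (x(j := single 0 a * u)) c - single (x(j := u)) (c * a) \<in> relation_ideal"
    if "x \<in> tuples" "j \<in> I" "u \<in> monomial_span (S j)"
    for x :: "'i \<Rightarrow> 'v \<Rightarrow>\<^sub>0 'f" and j u a c
  proof -
    have "single 0 a * u \<in> monomial_span (S j)"
      by (rule monomial_span_scale[OF that(3)])
    then have mem: "x(j := single 0 a * u) \<in> tuples" "x(j := u) \<in> tuples"
      using that by (intro update_mem_tuples; simp)+
    have "single (x(j := single 0 a * u)) 1 - single (x(j := u)) a \<in> relations"
      unfolding multilinear_relations_def using that by auto
    from J_scale[OF this, of c] show ?thesis
      by (simp add: scale_diff scale_single mem)
  qed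
  \<comment> \<open>Says that \<open>f\<close> agrees, modulo the relations, with the chosen
    combination of monomial tuples of the same value.\<close>
  define good where "good f \<longleftrightarrow> f - tensor_section I (tensor_eval I f) \<in> relation_ideal"
    for f :: "('i \<Rightarrow> 'v \<Rightarrow>\<^sub>0 'f) \<Rightarrow>\<^sub>0 'f"
  have good_cong: "good f" if "f - g \<in> relation_ideal" "good g" for f g
  proof -
    have "tensor_eval I f = tensor_eval I g"
      using sub that(1) mem_kernel_tensor_eval[of "f - g"] by (auto simp: tensor_eval_diff)
    then show ?thesis
      using J_add[OF that(1)] that(2) by (fastforce simp: good_def)
  qed
  have good_add: "good (f + g)" if "good f" "good g" for f g
    using J_add[OF that[unfolded good_def]]
    by (simp add: good_def tensor_eval_add tensor_section_add add_diff_add)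
  have good_zero: "good 0"
    using J.zero_closed by (simp add: good_def)
  \<comment> \<open>The set \<open>C\<close> holds the coordinates still to be expanded; all other
    entries are already monomials.\<close>
  have expand: "good (single x c)"
    if "finite C" "C \<subseteq> I" "x \<in> tuples" "\<And>i. i \<in> I - C \<Longrightarrow> x i \<in> monomials (S i)" for C x c
    using that
  proof (induction C arbitrary: x c)
    case empty
    have "x \<in> (\<Pi>\<^sub>E i\<in>I. monomials (S i))"
      using empty.prems(2,3) by (simp add: PiE_iff)
    then obtain t where "t \<in> T" "x = monomial_tuple I t"
      unfolding monomial_tuples by blast
    then show ?case
      using tensor_eval_monomial_tuple[OF \<open>t \<in> T\<close>, of c] J.zero_closed
      by (simp add: good_def tensor_section_single)
  next
    case (insert j C)
    have j: "j \<in> I"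
      using insert.prems(1) by simp
    have "good (single (x(j := u)) c)" if "keys u \<subseteq> S j" for u
      using that
    proof (induction u rule: poly_mapping_additive_induct)
      case zero
      \<comment> \<open>The scaling relation with factor 0 removes a tuple with a zero
        entry.\<close>
      have "single (x(j := 0)) c - 0 \<in> relation_ideal"
        using relation_scale[OF insert.prems(2) j monomial_span_zero, of 0 c] by simp
      then show ?case
        by (rule good_cong[OF _ good_zero])
    next
      case (single k a)
      then have mem: "single k 1 \<in> monomial_span (S j)"
        by (simp add: monomial_span_single)
      have "good (single (x(j := single k 1)) (c * a))"
        using insert.prems single by (intro insert.IH update_mem_tuples mem j) (auto simp: monomials_def)
      moreover have "single (x(j := single k a)) c - single (x(j := single k 1)) (c * a) \<in> relation_ideal"
        using relation_scale[OF insert.prems(2) j mem, of a c] by (simp add: mult_single)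
      ultimately show ?case
        using good_cong by blast
    next
      case (add u v)
      have "single (x(j := u + v)) c - (single (x(j := u)) c + single (x(j := v)) c) \<in> relation_ideal"
        using relation_add[OF insert.prems(2) j, of u v c] add.hyps by (simp add: monomial_span_def algebra_simps)
      then show ?case
        using good_cong good_add[OF add.IH] by blast
    qed
    from this[of "x j"] show ?case
      using insert.prems(2) j by (auto simp: monomial_span_def)
  qed
  have good: "good f" if "keys f \<subseteq> tuples" for f
    using that
  proof (induction f rule: poly_mapping_additive_induct)
    case (single x c)
    then show ?case
      by (intro expand[OF finite_index]) auto
  qed (simp_all add: good_zero good_add)
  show "?K \<subseteq> relation_ideal"
  proof
    fix f
    assume "f \<in> ?K"
    \<comment> \<open>On the kernel the section term is 0, so \<open>good f\<close> is membership in
      the ideal of relations.\<close>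
    then show "f \<in> relation_ideal"
      using good[of f] by (simp add: mem_kernel_tensor_eval good_def)
  qed
qed

text \<open>The first isomorphism theorem for the surjective evaluation, whose kernel is the ideal
  of relations. The pure tensor of a monomial tuple goes to the monomial with its exponent.\<close>

lemma tensor_algebra_iso:
  obtains h where
    "ring_isomorphism (tensor_algebra I (\<lambda>i. semigroup_algebra (S i)) :: (('i \<Rightarrow> 'v \<Rightarrow>\<^sub>0 'f::field) \<Rightarrow>\<^sub>0 'f) set ring)
      (semigroup_algebra T :: ('f, ('i \<Rightarrow>\<^sub>0 'v) \<Rightarrow>\<^sub>0 'f) module) h"
    "h ` tensor_monomials I S = monomials T"
    "(tensor_monomials I S :: (('i \<Rightarrow> 'v \<Rightarrow>\<^sub>0 'f) \<Rightarrow>\<^sub>0 'f) set set)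
      \<subseteq> carrier (tensor_algebra I (\<lambda>i. semigroup_algebra (S i)))"
proof -
  interpret A: cring "tuple_ring :: (('i \<Rightarrow> 'v \<Rightarrow>\<^sub>0 'f) \<Rightarrow>\<^sub>0 'f) ring"
    by (rule cring_tuple_ring)
  interpret h: ring_hom_ring "tuple_ring :: (('i \<Rightarrow> 'v \<Rightarrow>\<^sub>0 'f) \<Rightarrow>\<^sub>0 'f) ring"
      "semigroup_algebra T" "tensor_eval I"
    by (rule tensor_eval_hom)
  let ?A = "tensor_algebra I (\<lambda>i. semigroup_algebra (S i)) :: (('i \<Rightarrow> 'v \<Rightarrow>\<^sub>0 'f) \<Rightarrow>\<^sub>0 'f) set ring"
  let ?J = "relation_ideal :: (('i \<Rightarrow> 'v \<Rightarrow>\<^sub>0 'f) \<Rightarrow>\<^sub>0 'f) set"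
  \<comment> \<open>Sends a coset to the common value of \<open>tensor_eval I\<close> on its
    elements.\<close>
  let ?h = "\<lambda>C. the_elem (tensor_eval I ` C) :: ('i \<Rightarrow>\<^sub>0 'v) \<Rightarrow>\<^sub>0 'f"
  have J: "ideal ?J tuple_ring"
    using h.kernel_is_ideal by (simp only: tensor_ideal_eq_kernel)
  have A: "?A = tuple_ring Quot a_kernel tuple_ring (semigroup_algebra T) (tensor_eval I)"
    by (simp only: tensor_algebra_def tensor_ideal_eq_kernel)
  have "?h \<in> ring_iso ?A (semigroup_algebra T)"
    unfolding A by (rule h.FactRing_iso_set[OF tensor_eval_surj])
  moreover have "cring ?A"
    unfolding tensor_algebra_def by (rule ideal.quotient_is_cring[OF J cring_tuple_ring])
  ultimately have iso: "ring_isomorphism ?A (semigroup_algebra T) ?h"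
    by (intro ring_isomorphism.intro ring_isomorphism_axioms.intro product.cring_semigroup_algebra)
  have pure: "pure_tensor I (\<lambda>i. semigroup_algebra (S i)) x \<in> carrier ?A"
    "?h (pure_tensor I (\<lambda>i. semigroup_algebra (S i)) x) = tensor_eval I (single x 1)"
    if "x \<in> tuples" for x
  proof -
    have x: "single x 1 \<in> carrier (tuple_ring :: (('i \<Rightarrow> 'v \<Rightarrow>\<^sub>0 'f) \<Rightarrow>\<^sub>0 'f) ring)"
      using monomial_span_single[OF that, of 1] by (simp only: tuple_ring_simps monomial_span_def)
    have "?J \<subseteq> carrier tuple_ring"
      using ideal.Icarr[OF J] by blast
    from A.a_rcosetsI[OF this x] show "pure_tensor I (\<lambda>i. semigroup_algebra (S i)) x \<in> carrier ?A"
      by (simp only: pure_tensor_def tensor_algebra_def FactRing_def partial_object.simps)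
    show "?h (pure_tensor I (\<lambda>i. semigroup_algebra (S i)) x) = tensor_eval I (single x 1)"
      unfolding pure_tensor_def tensor_ideal_eq_kernel by (rule h.the_elem_simp[OF x])
  qed
  have "?h ` tensor_monomials I S = (\<lambda>t. ?h (pure_tensor I (\<lambda>i. semigroup_algebra (S i)) (monomial_tuple I t))) ` T"
    by (simp only: tensor_monomials_def monomial_tuples image_image)
  also have "\<dots> = monomials T"
    unfolding monomials_def
    by (rule image_cong) (simp_all add: pure monomial_tuple_mem tensor_eval_monomial_tuple)
  finally have "?h ` tensor_monomials I S = monomials T" .
  moreover have "tensor_monomials I S \<subseteq> carrier ?A"
    unfolding tensor_monomials_def monomial_tuples using pure(1) monomial_tuple_mem by blast
  ultimately show thesis
    by (rule that[OF iso])
qed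

end

section \<open>Normal affine semigroup rings\<close>

text \<open>Integer combinations add coefficientwise and the pairing is additive in its first
  argument, so the lattice and the dual cone are both closed under addition.\<close>

lemma additive_submonoid_normal_semigroup:
  assumes "dual_lattices M N p"
  shows "additive_submonoid (normal_semigroup M p G)"
proof
  have lin: "linear (\<lambda>w. p w v)" for v
    using assms by (simp add: dual_lattices_def bilinear_def)
  obtain B where B: "M = {\<Sum>b\<in>B. real_of_int (k b) *\<^sub>R b | k. True}"
    using assms by (auto simp: dual_lattices_def is_lattice_def)
  have "0 \<in> M"
    unfolding B by (auto intro!: exI[of _ "\<lambda>_. 0"])
  then show "0 \<in> normal_semigroup M p G"
    by (auto simp: normal_semigroup_def dual_cone_def linear_0[OF lin] span_zero)
  fix a b
  assume ab: "a \<in> normal_semigroup M p G" "b \<in> normal_semigroup M p G"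
  then obtain k l where "a = (\<Sum>b\<in>B. real_of_int (k b) *\<^sub>R b)" "b = (\<Sum>b\<in>B. real_of_int (l b) *\<^sub>R b)"
    by (auto simp: normal_semigroup_def B)
  then have "a + b = (\<Sum>b\<in>B. real_of_int (k b + l b) *\<^sub>R b)"
    by (simp add: scaleR_add_left sum.distrib)
  then have "a + b \<in> M"
    unfolding B by (intro CollectI exI[of _ "\<lambda>b. k b + l b"]) simp
  then show "a + b \<in> normal_semigroup M p G"
    using ab by (auto simp: normal_semigroup_def dual_cone_def linear_add[OF lin] span_add)
qed

theorem theorem1p2:
  fixes n :: nat
    and M :: "nat \<Rightarrow> 'v::real_vector set"
    and N :: "nat \<Rightarrow> 'w::real_vector set"
    and p :: "nat \<Rightarrow> 'v \<Rightarrow> 'w \<Rightarrow> real"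
    and G :: "nat \<Rightarrow> 'w set"
    and S :: "nat \<Rightarrow> 'v set"
    and R :: "nat \<Rightarrow> ('f::field, 'v \<Rightarrow>\<^sub>0 'f) module"
    and D :: "nat \<Rightarrow> nat"
  assumes "n \<ge> 1"
    and "\<And>i. i \<in> {1..n} \<Longrightarrow> dual_lattices (M i) (N i) (p i)"
    and "\<And>i. i \<in> {1..n} \<Longrightarrow> finite (G i) \<and> G i \<subseteq> N i - {0}"
    and "\<And>i. S i = normal_semigroup (M i) (p i) (G i)"
    and "\<And>i. R i = semigroup_algebra (S i)"
    and "\<And>i. i \<in> {1..n} \<Longrightarrow> D i > 0"
    and "\<And>i r P. i \<in> {1..n} \<Longrightarrow> r > 0 \<Longrightarrow> monomial_prime (R i) (monomials (S i)) P \<Longrightarrow>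
           symbolic_power (R i) P (D i * (r - 1) + 1) \<subseteq> ideal_power (R i) P r"
  shows "\<forall>r>0. \<forall>Q. monomial_prime (tensor_algebra {1..n} R) (tensor_monomials {1..n} S) Q \<longrightarrow>
           symbolic_power (tensor_algebra {1..n} R) Q (Max (D ` {1..n}) * (r - 1) + 1)
             \<subseteq> ideal_power (tensor_algebra {1..n} R) Q r"
proof (intro allI impI)
  fix r :: nat and Q
  assume r: "r > 0" and Q: "monomial_prime (tensor_algebra {1..n} R) (tensor_monomials {1..n} S) Q"
  interpret submonoid_family "{1..n}" S
    by (rule submonoid_family.intro)
      (simp, simp only: assms(4), rule additive_submonoid_normal_semigroup, rule assms(2))
  have R: "R = (\<lambda>i. semigroup_algebra (S i))"
    using assms(5) by (rule ext)
  have unique: "unique_sums TYPE('v)" "unique_sums TYPE(nat \<Rightarrow>\<^sub>0 'v)"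
    by (simp_all add: unique_sums_real_vector unique_sums_poly_mapping)
  obtain h where h: "ring_isomorphism (tensor_algebra {1..n} R)
      (semigroup_algebra T :: ('f, (nat \<Rightarrow>\<^sub>0 'v) \<Rightarrow>\<^sub>0 'f) module) h"
    "h ` tensor_monomials {1..n} S = monomials T"
    "tensor_monomials {1..n} S \<subseteq> carrier (tensor_algebra {1..n} R)"
    unfolding R by (rule tensor_algebra_iso)
  interpret h: ring_isomorphism "tensor_algebra {1..n} R"
      "semigroup_algebra T :: ('f, (nat \<Rightarrow>\<^sub>0 'v) \<Rightarrow>\<^sub>0 'f) module" h
    by (rule h(1))
  have prime: "primeideal Q (tensor_algebra {1..n} R)"
    using Q by (simp add: monomial_prime_def)
  have "monomial_prime (semigroup_algebra T) (monomials T) (h ` Q)"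
    using h.monomial_prime_image[OF h(3) Q] by (simp only: h(2))
  then obtain E where E: "prime_semigroup_ideal T E" "h ` Q = monomial_span E"
    by (rule product.monomial_primeE)
  \<comment> \<open>For each factor the assumption is applied to the contracted prime. All ideals
    involved are spanned by monomials, so the inclusion becomes one between sets of
    exponents.\<close>
  have bound: "semigroup_symbolic_power (S i) (component_ideal S E i) (D i * (k - 1) + 1)
      \<subseteq> semigroup_power (S i) (component_ideal S E i) k" if i: "i \<in> {1..n}" and k: "k > 0" for i k
  proof -
    interpret Si: additive_submonoid "S i"
      by (rule submonoid[OF i])
    let ?P = "monomial_span (component_ideal S E i) :: ('v \<Rightarrow>\<^sub>0 'f) set"
    have "prime_semigroup_ideal (S i) (component_ideal S E i)"
      by (rule prime_component_ideal[OF E(1) i])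
    note P = unique(1) this
    have "symbolic_power (semigroup_algebra (S i)) ?P (D i * (k - 1) + 1)
        \<subseteq> ideal_power (semigroup_algebra (S i)) ?P k"
      using assms(7)[OF i k, of ?P] Si.monomial_primeI[OF P] by (simp only: R)
    then show ?thesis
      by (simp only: Si.symbolic_power_monomial_span[OF P] Si.ideal_power_monomial_span
          monomial_span_subset_iff)
  qed
  have "semigroup_symbolic_power T E (Max (D ` {1..n}) * (r - 1) + 1) \<subseteq> semigroup_power T E r"
    using assms(1,6) by (intro product_symbolic_power_bound[OF E(1) _ _ bound r]) auto
  \<comment> \<open>The inclusion of exponent sets is turned back into one of ideals, which is then
    pulled back along \<open>h\<close>.\<close>
  then have "symbolic_power (semigroup_algebra T) (h ` Q) (Max (D ` {1..n}) * (r - 1) + 1)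
      \<subseteq> ideal_power (semigroup_algebra T) (h ` Q) r"
    by (simp only: E(2) product.symbolic_power_monomial_span[OF unique(2) E(1)]
        product.ideal_power_monomial_span monomial_span_subset_iff)
  then show "symbolic_power (tensor_algebra {1..n} R) Q (Max (D ` {1..n}) * (r - 1) + 1)
      \<subseteq> ideal_power (tensor_algebra {1..n} R) Q r"
    by (rule h.symbolic_power_subset_transfer[OF prime])
qed

end
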